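(* Fix an integer $k\ge 1$ and let $\mathcal{L}_{\geq k, n}$ be the number of nodes with at least $k$ descendants in a uniform recursive tree of order $n$. Then, as $n\to\infty$, $$\frac{\mathcal{L}_{\geq k, n} - \frac{n}{k+1}}{\sqrt{n \left(\frac{1}{k+1} + \frac{2H_{2k+1}-2H_{k+1}}{k+1} - \frac{2k+1}{(k+1)^2} \right)}} \longrightarrow_d \mathcal{G},$$ where $\mathcal{G}$ is a standard normal random variable, $H_m=\sum_{i=1}^m\frac1i$, and $\longrightarrow_d$ denotes convergence in distribution.
   Context: A uniform recursive tree (URT) of order $n$ is a uniformly random tree among the $(n-1)!$ increasing rooted trees on $\{1,\dots,n\}$ (rooted at $1$, labels increasing along every path away from the root); equivalently, node $1$ is the root and for $i=2,\dots,n$ node $i$ is attached to a node chosen uniformly from $\{1,\dots,i-1\}$, independently of previous choices. A descendant of a vertex $v$ is any vertex that is a child of $v$ or a descendant of a child of $v$ (so $v$ is not its own descendant). *)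

theory Defs
  imports "HOL-Probability.Probability"
begin

text \<open>
  A rooted tree on the vertex set \<open>V\<close> is represented by the set \<open>T\<close> of its edges, oriented away
  from the root: \<open>(p, c) \<in> T\<close> means that \<open>p\<close> is the parent of \<open>c\<close>.
\<close>

definition rooted_tree :: "'a set \<Rightarrow> 'a \<Rightarrow> ('a \<times> 'a) set \<Rightarrow> bool" where
  "rooted_tree V r T \<longleftrightarrow>
     r \<in> V \<and> T \<subseteq> V \<times> V \<and>
     (\<forall>p. (p, r) \<notin> T) \<and>
     (\<forall>v \<in> V - {r}. \<exists>!p. (p, v) \<in> T) \<and>
     (\<forall>v \<in> V. (r, v) \<in> T\<^sup>*)"

definition increasing_trees :: "nat \<Rightarrow> (nat \<times> nat) set set" where
  "increasing_trees n = {T. rooted_tree {1..n} 1 T \<and> (\<forall>(u, v) \<in> T\<^sup>+. u < v)}"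

text \<open>
  The law of a uniform recursive tree of order \<open>n\<close>. It is meaningful for \<open>n \<ge> 1\<close> only: the set
  \<open>increasing_trees 0\<close> is empty, so that \<open>urt 0\<close> is an unspecified distribution.
\<close>

definition urt :: "nat \<Rightarrow> (nat \<times> nat) set pmf" where
  "urt n = pmf_of_set (increasing_trees n)"

definition descendants :: "('a \<times> 'a) set \<Rightarrow> 'a \<Rightarrow> 'a set" where
  "descendants T v = {w. (v, w) \<in> T\<^sup>+}"

definition num_nodes_ge :: "nat \<Rightarrow> nat \<Rightarrow> (nat \<times> nat) set \<Rightarrow> nat" where
  "num_nodes_ge k n T = card {v \<in> {1..n}. k \<le> card (descendants T v)}"

lemma descendants_rec:
  "descendants T v = {w. (v, w) \<in> T} \<union> (\<Union>u \<in> {u. (v, u) \<in> T}. descendants T u)"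
  unfolding descendants_def by (auto dest: tranclD intro: trancl_into_trancl2 elim: converse_tranclE)

text \<open>
  Agreement with the construction by successive uniform attachments, where \<open>f i\<close> is the node to
  which node \<open>i\<close> is attached.
\<close>

definition tree_of_parents :: "nat \<Rightarrow> (nat \<Rightarrow> nat) \<Rightarrow> (nat \<times> nat) set" where
  "tree_of_parents n f = (\<lambda>i. (f i, i)) ` {2..n}"

lemma in_tree_of_parents [simp]:
  "(p, c) \<in> tree_of_parents n f \<longleftrightarrow> c \<in> {2..n} \<and> p = f c"
  by (auto simp: tree_of_parents_def)

lemma tree_of_parents_increasing:
  assumes f: "\<And>i. i \<in> {2..n} \<Longrightarrow> f i \<in> {1..<i}" and n: "n \<ge> 1"
  shows "tree_of_parents n f \<in> increasing_trees n"
proof -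
  let ?T = "tree_of_parents n f"
  have sub: "?T \<subseteq> {1..n} \<times> {1..n}"
  proof safe
    fix a b assume "(a, b) \<in> ?T"
    then show "a \<in> {1..n}" "b \<in> {1..n}"
      using f[of b] by auto
  qed
  have reach: "(1, v) \<in> ?T\<^sup>*" if "v \<in> {1..n}" for v
    using that
  proof (induction v rule: less_induct)
    case (less v)
    show ?case
    proof (cases "v = 1")
      case False
      with less.prems have v: "v \<in> {2..n}" by auto
      have "(1, f v) \<in> ?T\<^sup>*" using less.IH[of "f v"] f[OF v] v by auto
      moreover have "(f v, v) \<in> ?T" using v by auto
      ultimately show ?thesis by (rule rtrancl_into_rtrancl)
    qed auto
  qed
  have inc: "u < v" if "(u, v) \<in> ?T\<^sup>+" for u v
    using that
  proof (induction rule: trancl_induct)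
    case (base y) then show ?case using f[of y] by auto
  next
    case (step y z) then show ?case using f[of z] by auto
  qed
  have uniq: "\<exists>!p. (p, v) \<in> ?T" if "v \<in> {1..n} - {1}" for v
    using that by auto
  show ?thesis
    unfolding increasing_trees_def rooted_tree_def
    using sub reach inc uniq n by auto
qed

lemma increasing_tree_has_parents:
  assumes T: "T \<in> increasing_trees n"
  obtains f where "f \<in> (\<Pi>\<^sub>E i\<in>{2..n}. {1..<i})" "T = tree_of_parents n f"
proof -
  have sub: "T \<subseteq> {1..n} \<times> {1..n}" and root: "\<And>p. (p, 1) \<notin> T"
    and uniq: "\<And>v. v \<in> {1..n} - {1} \<Longrightarrow> \<exists>!p. (p, v) \<in> T"
    and inc: "\<And>u v. (u, v) \<in> T \<Longrightarrow> u < v"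
    using T unfolding increasing_trees_def rooted_tree_def by auto
  define f where "f = (\<lambda>i\<in>{2..n}. THE p. (p, i) \<in> T)"
  have par: "(f v, v) \<in> T" if "v \<in> {2..n}" for v
    using theI'[OF uniq[of v]] that by (auto simp: f_def)
  have "f v \<in> {1..<v}" if "v \<in> {2..n}" for v
    using par[OF that] sub inc by auto
  then have "f \<in> (\<Pi>\<^sub>E i\<in>{2..n}. {1..<i})"
    by (auto simp: f_def)
  moreover have "T = tree_of_parents n f"
  proof (rule set_eqI, safe)
    fix a b assume ab: "(a, b) \<in> T"
    then have "b \<noteq> 1" using root by auto
    then have b: "b \<in> {2..n}" using sub ab by fastforce
    then show "(a, b) \<in> tree_of_parents n f"
      using uniq[of b] par[OF b] ab by auto
  next
    fix a b assume "(a, b) \<in> tree_of_parents n f"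
    then show "(a, b) \<in> T" using par[of b] by auto
  qed
  ultimately show ?thesis by (rule that)
qed

lemma bij_betw_tree_of_parents:
  assumes "n \<ge> 1"
  shows "bij_betw (tree_of_parents n) (\<Pi>\<^sub>E i\<in>{2..n}. {1..<i}) (increasing_trees n)"
  unfolding bij_betw_def
proof
  show "inj_on (tree_of_parents n) (\<Pi>\<^sub>E i\<in>{2..n}. {1..<i})"
  proof (rule inj_onI)
    fix f g assume f: "f \<in> (\<Pi>\<^sub>E i\<in>{2..n}. {1..<i})" and g: "g \<in> (\<Pi>\<^sub>E i\<in>{2..n}. {1..<i})"
      and eq: "tree_of_parents n f = tree_of_parents n g"
    have "f i = g i" if "i \<in> {2..n}" for i
      using that in_tree_of_parents[of "f i" i n f] in_tree_of_parents[of "f i" i n g] eq by simp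
    then show "f = g" by (rule PiE_ext[OF f g])
  qed
  show "tree_of_parents n ` (\<Pi>\<^sub>E i\<in>{2..n}. {1..<i}) = increasing_trees n"
  proof (intro equalityI subsetI)
    fix T assume "T \<in> tree_of_parents n ` (\<Pi>\<^sub>E i\<in>{2..n}. {1..<i})"
    then obtain f where f: "f \<in> (\<Pi>\<^sub>E i\<in>{2..n}. {1..<i})" "T = tree_of_parents n f" by auto
    show "T \<in> increasing_trees n"
      unfolding f(2) by (rule tree_of_parents_increasing[OF PiE_mem[OF f(1)] assms])
  next
    fix T assume "T \<in> increasing_trees n"
    then show "T \<in> tree_of_parents n ` (\<Pi>\<^sub>E i\<in>{2..n}. {1..<i})"
      by (metis increasing_tree_has_parents image_eqI)
  qed
qed

lemma finite_increasing_trees: "finite (increasing_trees n)"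
proof (rule finite_subset)
  show "increasing_trees n \<subseteq> Pow ({1..n} \<times> {1..n})"
    by (auto simp: increasing_trees_def rooted_tree_def)
qed auto

lemma card_increasing_trees:
  assumes "n \<ge> 1"
  shows "card (increasing_trees n) = fact (n - 1)"
proof -
  have "card (increasing_trees n) = card (\<Pi>\<^sub>E i\<in>{2..n}. {1..<i})"
    using bij_betw_same_card[OF bij_betw_tree_of_parents[OF assms]] by simp
  also have "\<dots> = (\<Prod>i\<in>{2..n}. i - 1)" by (simp add: card_PiE)
  also have "\<dots> = (\<Prod>i\<in>{1..n - 1}. i)"
    by (rule prod.reindex_bij_witness[of _ "\<lambda>i. i + 1" "\<lambda>i. i - 1"]) auto
  also have "\<dots> = fact (n - 1)" by (simp add: fact_prod)
  finally show ?thesis .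
qed

lemma urt_eq_uniform_attachment:
  assumes "n \<ge> 1"
  shows "urt n = map_pmf (tree_of_parents n) (Pi_pmf {2..n} undefined (\<lambda>i. pmf_of_set {1..<i}))"
proof -
  have ne: "(\<Pi>\<^sub>E i\<in>{2..n}. {1..<i}) \<noteq> {}" by (auto simp: PiE_eq_empty_iff)
  have "PiE_dflt {2..n} undefined (\<lambda>i. {1..<i}) = (\<Pi>\<^sub>E i\<in>{2..n}. {1..<i})"
    by (auto simp: PiE_dflt_def PiE_def Pi_def extensional_def)
  then have "Pi_pmf {2..n} undefined (\<lambda>i. pmf_of_set {1..<i}) = pmf_of_set (\<Pi>\<^sub>E i\<in>{2..n}. {1..<i})"
    by (subst Pi_pmf_of_set) auto
  then show ?thesis
    using map_pmf_of_set_bij_betw[OF bij_betw_tree_of_parents[OF assms] ne]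
    by (simp add: urt_def finite_PiE)
qed

end

theory Submission
  imports Defs "HOL-Combinatorics.Multiset_Permutations"
begin

text \<open>
  A recursive tree of order \<open>n\<close> is encoded by a word in the letters \<open>1, \<dots>, n\<close>: starting from the word
  \<open>1\<close>, each new node is inserted directly behind its parent. By induction, the descendants of a node
  \<open>v\<close> are the letters in the maximal block of letters larger than \<open>v\<close> that directly follows \<open>v\<close>
  (\<open>descendants_eq_larger_run\<close>). The encoding is a bijection from the increasing trees onto the words that
  consist of \<open>1\<close> and a permutation of \<open>2, \<dots>, n\<close> (\<open>bij_betw_attachment_word\<close>). Hence the number of nodes
  with at least \<open>k\<close> descendants is the number of positions whose letter is smaller than each of the next
  \<open>k\<close> letters, in a uniform permutation with an additional minimum in front.

  The uniform permutation may be replaced by independent, uniformly distributed real numbers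
  \<open>U\<^sub>0, U\<^sub>1, \<dots>\<close> (\<open>expectation_count_runs\<close>). For \<open>n > k\<close> the statistic then becomes one plus the
  number of \<open>i < n - 1 - k\<close> such that \<open>U\<^sub>i\<close> is smaller than each of the next \<open>k\<close> variables. These events
  are stationary, and they are independent if their indices differ by more than \<open>k\<close>. By symmetry, each of
  them has the probability \<open>1 / (k + 1)\<close>, and two of them at a distance \<open>d\<close> between \<open>1\<close> and \<open>k\<close> occur together
  with the probability \<open>1 / ((k + 1) * (k + 1 + d))\<close>, since the earlier variable then is the minimum of
  \<open>k + 1 + d\<close> variables and the later one the minimum of \<open>k + 1\<close> of them. Summing the covariances yields
  the limiting variance.

  It remains to prove the central limit theorem for such sequences (\<open>central_limit\<close> in the locale
  \<open>stationary_m_dependent\<close>). The indices are cut into blocks of length \<open>B\<close> that are separated by gaps of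
  length \<open>k\<close>. The block sums are independent and identically distributed, so that the classical theorem
  applies to them. The gaps contribute a proportion of the variance of order \<open>k / B\<close>, which vanishes as \<open>B\<close>
  grows. The comparison is made through characteristic functions, whose difference is bounded by the
  distance in mean, and Levy's continuity theorem concludes.
\<close>

section \<open>Recursive trees as words\<close>

text \<open>
  Inserts \<open>x\<close> directly behind the first occurrence of \<open>p\<close>.
\<close>
fun insert_after :: "'a \<Rightarrow> 'a \<Rightarrow> 'a list \<Rightarrow> 'a list" where
  "insert_after p x [] = []"
| "insert_after p x (y # ys) = (if y = p then y # x # ys else y # insert_after p x ys)"

text \<open>
  The set of letters in the maximal block of letters larger than \<open>v\<close> that directly follows the first
  occurrence of \<open>v\<close>; it is empty if \<open>v\<close> does not occur.
\<close>
fun larger_run :: "'a :: linorder list \<Rightarrow> 'a \<Rightarrow> 'a set" where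
  "larger_run [] v = {}"
| "larger_run (x # xs) v = (if x = v then set (takeWhile (\<lambda>z. v < z) xs) else larger_run xs v)"

text \<open>
  The number of positions at which the letter is directly followed by at least \<open>k\<close> letters that are
  all larger than it.
\<close>
fun count_runs :: "nat \<Rightarrow> 'a :: linorder list \<Rightarrow> nat" where
  "count_runs k [] = 0"
| "count_runs k (x # xs) = (if k \<le> length (takeWhile (\<lambda>z. x < z) xs) then 1 else 0) + count_runs k xs"

lemma set_insert_after [simp]: "p \<in> set w \<Longrightarrow> set (insert_after p x w) = insert x (set w)"
  by (induction w) auto

lemma distinct_insert_after:
  "distinct w \<Longrightarrow> x \<notin> set w \<Longrightarrow> distinct (insert_after p x w)"
proof (induction w)
  case (Cons y ys)
  have "set (insert_after p x ys) \<subseteq> insert x (set ys)" for ys by (induction ys) auto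
  with Cons show ?case by auto
qed auto

lemma insert_after_append:
  "p \<notin> set as \<Longrightarrow> insert_after p x (as @ p # bs) = as @ p # x # bs"
  by (induction as) auto

lemma larger_run_subset: "larger_run w v \<subseteq> set w"
proof (induction w)
  case (Cons x xs)
  have "set (takeWhile (\<lambda>z. v < z) xs) \<subseteq> set xs" by (meson set_takeWhileD subsetI)
  with Cons show ?case by auto
qed simp

lemma set_takeWhile_insert_after:
  assumes "v < x" "distinct w"
  shows "set (takeWhile (\<lambda>z. v < z) (insert_after p x w)) =
    set (takeWhile (\<lambda>z. v < z) w) \<union> (if p \<in> set (takeWhile (\<lambda>z. v < z) w) then {x} else {})"
  using assms
proof (induction w)
  case (Cons y ys)
  have "set (takeWhile (\<lambda>z. v < z) ys) \<subseteq> set ys" by (meson set_takeWhileD subsetI)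
  then have "y = p \<Longrightarrow> p \<notin> set (takeWhile (\<lambda>z. v < z) ys)" using Cons.prems by auto
  with Cons.IH Cons.prems show ?case by (cases "v < y"; cases "y = p") (simp_all add: insert_commute)
qed simp

text \<open>
  Inserting a new largest letter behind \<open>p\<close> adds it to the runs of \<open>p\<close> and of the letters whose run
  contains \<open>p\<close>. In the same way, a new child of the node \<open>p\<close> becomes a descendant of \<open>p\<close> and of the
  ancestors of \<open>p\<close>.
\<close>
lemma larger_run_insert_after:
  assumes "distinct w" "p \<in> set w" "\<And>y. y \<in> set w \<Longrightarrow> y < x"
  shows "larger_run (insert_after p x w) v =
    (if v = x then {} else larger_run w v \<union> (if v = p \<or> p \<in> larger_run w v then {x} else {}))"
  using assms
proof (induction w)
  case (Cons y ys)
  show ?case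
  proof (cases "y = p")
    case True
    have "takeWhile (\<lambda>z. x < z) ys = []"
      using Cons.prems(3) by (cases ys) (auto dest: order.asym)
    moreover have "p < x" using Cons.prems True by auto
    moreover have "p \<notin> larger_run ys v" using Cons.prems(1) True larger_run_subset[of ys v] by auto
    ultimately show ?thesis using True by (cases "v = x"; cases "v = p") auto
  next
    case False
    have "y < x" using Cons.prems by auto
    have IH: "larger_run (insert_after p x ys) v =
      (if v = x then {} else larger_run ys v \<union> (if v = p \<or> p \<in> larger_run ys v then {x} else {}))"
      using Cons.prems False by (intro Cons.IH) auto
    have "set (takeWhile (\<lambda>z. y < z) (insert_after p x ys)) = set (takeWhile (\<lambda>z. y < z) ys) \<union>
        (if p \<in> set (takeWhile (\<lambda>z. y < z) ys) then {x} else {})"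
      using set_takeWhile_insert_after[of y x ys p] \<open>y < x\<close> Cons.prems(1) by simp
    then show ?thesis using False \<open>y < x\<close> IH by (cases "v = x"; cases "v = y") auto
  qed
qed auto

lemma card_larger_run_eq_count_runs:
  assumes "distinct w"
  shows "card {v \<in> set w. k \<le> card (larger_run w v)} = count_runs k w"
  using assms
proof (induction w)
  case (Cons x xs)
  have "{v \<in> set (x # xs). k \<le> card (larger_run (x # xs) v)} =
     {v. v = x \<and> k \<le> length (takeWhile (\<lambda>z. x < z) xs)} \<union> {v \<in> set xs. k \<le> card (larger_run xs v)}"
    using Cons.prems by (auto simp: distinct_card distinct_takeWhile)
  also have "card \<dots> = card {v. v = x \<and> k \<le> length (takeWhile (\<lambda>z. x < z) xs)}
      + card {v \<in> set xs. k \<le> card (larger_run xs v)}"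
    using Cons.prems by (intro card_Un_disjoint) auto
  finally show ?case using Cons by auto
qed auto

lemma length_takeWhile_ge_iff:
  "k \<le> length (takeWhile Q xs) \<longleftrightarrow> k \<le> length xs \<and> (\<forall>j<k. Q (xs ! j))"
proof (induction xs arbitrary: k)
  case (Cons x xs)
  then show ?case by (cases k) (auto simp: less_Suc_eq_0_disj)
qed auto

lemma count_runs_eq_card:
  "count_runs k w = card {i. i + k < length w \<and> (\<forall>j\<in>{1..k}. w ! i < w ! (i + j))}"
proof (induction w)
  case (Cons x xs)
  define N where "N = {i. i + k < length xs \<and> (\<forall>j\<in>{1..k}. xs ! i < xs ! (i + j))}"
  have fin: "finite N" unfolding N_def by (rule finite_subset[of _ "{..<length xs}"]) auto
  have *: "(k \<le> length (takeWhile (\<lambda>z. x < z) xs)) \<longleftrightarrow> k \<le> length xs \<and> (\<forall>j\<in>{1..k}. x < (x # xs) ! j)"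
    unfolding length_takeWhile_ge_iff
  proof (intro conj_cong refl iffI ballI allI impI)
    fix j assume "\<forall>j<k. x < xs ! j" "j \<in> {1..k}"
    then show "x < (x # xs) ! j" by (cases j) auto
  next
    fix j assume "\<forall>j\<in>{1..k}. x < (x # xs) ! j" "j < k"
    from bspec[OF this(1), of "Suc j"] this(2) show "x < xs ! j" by auto
  qed
  have "{i. i + k < length (x # xs) \<and> (\<forall>j\<in>{1..k}. (x # xs) ! i < (x # xs) ! (i + j))} =
     {i::nat. i = 0 \<and> k \<le> length (takeWhile (\<lambda>z. x < z) xs)} \<union> Suc ` N" (is "?A = ?B")
  proof (rule set_eqI)
    fix i show "i \<in> ?A \<longleftrightarrow> i \<in> ?B" unfolding * N_def by (cases i) auto
  qed
  also have "card \<dots> = card {i::nat. i = 0 \<and> k \<le> length (takeWhile (\<lambda>z. x < z) xs)} + card (Suc ` N)"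
  proof (rule card_Un_disjoint)
    show "finite {i::nat. i = 0 \<and> k \<le> length (takeWhile (\<lambda>z. x < z) xs)}"
      by (rule finite_subset[of _ "{0}"]) auto
  qed (use fin in auto)
  also have "card (Suc ` N) = count_runs k xs"
    using Cons by (simp add: card_image N_def)
  finally show ?case by (simp add: if_distrib cong: if_cong)
qed auto

lemma count_runs_map:
  assumes "strict_mono_on (set w) g"
  shows "count_runs k (map g w) = count_runs k w"
  using assms
proof (induction w)
  case (Cons x xs)
  have "takeWhile (\<lambda>z. g x < g z) xs = takeWhile (\<lambda>z. x < z) xs"
    using Cons.prems by (intro takeWhile_cong) (auto simp: strict_mono_on_less)
  moreover have "strict_mono_on (set xs) g" using Cons.prems by (auto simp: strict_mono_on_def)
  ultimately show ?case using Cons.IH by (simp add: takeWhile_map comp_def)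
qed auto

text \<open>
  The word that encodes the recursive tree of order \<open>m + 1\<close> in which node \<open>i\<close> is attached to \<open>f i\<close>: each
  new node is written directly behind its parent. The word starts with the root \<open>1\<close>, and the argument
  \<open>m\<close> is the number of the other nodes.
\<close>
fun attachment_word :: "(nat \<Rightarrow> nat) \<Rightarrow> nat \<Rightarrow> nat list" where
  "attachment_word f 0 = [1]"
| "attachment_word f (Suc m) = insert_after (f (m + 2)) (m + 2) (attachment_word f m)"

lemma attachment_word_props:
  assumes "\<And>i. i \<in> {2..m + 1} \<Longrightarrow> f i \<in> {1..<i}"
  shows "set (attachment_word f m) = {1..m + 1} \<and> distinct (attachment_word f m)
    \<and> hd (attachment_word f m) = 1 \<and> attachment_word f m \<noteq> []"
  using assms
proof (induction m)
  case (Suc m)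
  let ?w = "attachment_word f m"
  have IH: "set ?w = {1..m + 1}" "distinct ?w" "hd ?w = 1" "?w \<noteq> []" using Suc by auto
  have f: "f (m + 2) \<in> set ?w" using Suc.prems[of "m + 2"] IH by auto
  have "hd (insert_after p x w) = hd w \<and> insert_after p x w \<noteq> []" if "w \<noteq> []" for p x and w :: "nat list"
    using that by (cases w) auto
  moreover have "distinct (insert_after (f (m + 2)) (m + 2) ?w)"
    using IH by (intro distinct_insert_after) auto
  ultimately show ?case using f IH by auto
qed auto

lemma tree_of_parents_Suc:
  "n \<ge> 1 \<Longrightarrow> tree_of_parents (Suc n) f = insert (f (Suc n), Suc n) (tree_of_parents n f)"
  unfolding tree_of_parents_def by (auto simp: atLeastAtMostSuc_conv)

lemma descendants_eq_larger_run:
  assumes "\<And>i. i \<in> {2..m + 1} \<Longrightarrow> f i \<in> {1..<i}"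
  shows "descendants (tree_of_parents (m + 1) f) v = larger_run (attachment_word f m) v"
  using assms
proof (induction m arbitrary: v)
  case 0
  then show ?case by (auto simp: descendants_def tree_of_parents_def)
next
  case (Suc m)
  let ?T = "tree_of_parents (m + 1) f" and ?w = "attachment_word f m" and ?x = "m + 2"
  have w: "set ?w = {1..m + 1}" "distinct ?w" using attachment_word_props[of m f] Suc.prems by auto
  have fx: "f ?x \<in> {1..m+1}" using Suc.prems[of ?x] by auto
  have T: "tree_of_parents (Suc m + 1) f = insert (f ?x, ?x) ?T"
    using tree_of_parents_Suc[of "m + 1" f] by simp
  have sub: "?T \<subseteq> {1..m+1} \<times> {1..m+1}"
    using Suc.prems by (fastforce simp: tree_of_parents_def)
  have tsub: "?T\<^sup>+ \<subseteq> {1..m+1} \<times> {1..m+1}" by (rule trancl_subset_Sigma[OF sub])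
  have IH: "descendants ?T v = larger_run ?w v" for v using Suc by auto
  have xr: "(?x, b) \<in> ?T\<^sup>* \<longleftrightarrow> b = ?x" for b
    using tsub by (auto simp: rtrancl_eq_or_trancl)
  have "descendants (insert (f ?x, ?x) ?T) v =
      descendants ?T v \<union> (if v = f ?x \<or> f ?x \<in> descendants ?T v then {?x} else {})"
    unfolding descendants_def trancl_insert xr by (auto simp: rtrancl_eq_or_trancl)
  also have "\<dots> = larger_run (insert_after (f ?x) ?x ?w) v"
  proof -
    have "descendants ?T ?x = {}" using tsub unfolding descendants_def by auto
    then show ?thesis
      using fx w IH[of v] by (subst larger_run_insert_after) auto
  qed
  finally show ?case unfolding T by simp
qed

lemma num_nodes_ge_eq_count_runs:
  assumes "\<And>i. i \<in> {2..m + 1} \<Longrightarrow> f i \<in> {1..<i}"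
  shows "num_nodes_ge k (m + 1) (tree_of_parents (m + 1) f) = count_runs k (attachment_word f m)"
proof -
  have w: "set (attachment_word f m) = {1..m + 1}" "distinct (attachment_word f m)"
    using attachment_word_props[of m f] assms by auto
  show ?thesis
    using card_larger_run_eq_count_runs[OF w(2), of k] descendants_eq_larger_run[of m f, OF assms]
    unfolding num_nodes_ge_def w(1) by simp
qed

lemma attachment_word_cong:
  "(\<And>i. i \<in> {2..m + 1} \<Longrightarrow> f i = g i) \<Longrightarrow> attachment_word f m = attachment_word g m"
  by (induction m) auto

lemma attachment_word_surj:
  assumes "xs \<in> permutations_of_set {2..m + 1}"
  shows "\<exists>f. (\<forall>i\<in>{2..m + 1}. f i \<in> {1..<i}) \<and> attachment_word f m = 1 # xs"
  using assms
proof (induction m arbitrary: xs)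
  case 0
  then show ?case by auto
next
  case (Suc m)
  have xs: "set xs = {2..m + 2}" "distinct xs" using Suc.prems by (auto simp: permutations_of_set_def)
  then have "m + 2 \<in> set xs" by auto
  then obtain as bs where ab: "xs = as @ (m + 2) # bs" by (meson split_list)
  \<comment> \<open>The parent of the last node \<open>m + 2\<close> has to be the letter in front of it.\<close>
  define p where "p = last (1 # as)"
  define cs where "cs = butlast (1 # as)"
  have pc: "1 # as = cs @ [p]" unfolding p_def cs_def by (rule append_butlast_last_id[symmetric]) simp
  have "set (as @ bs) = {2..m+1}"
  proof -
    have "set (as @ bs) = set xs - {m + 2}" using xs(2) ab by auto
    then show ?thesis using xs(1) by auto
  qed
  then have "as @ bs \<in> permutations_of_set {2..m + 1}" using xs(2) ab by (auto simp: permutations_of_set_def)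
  from Suc.IH[OF this] obtain f where f: "\<forall>i\<in>{2..m + 1}. f i \<in> {1..<i}"
    "attachment_word f m = 1 # as @ bs" by blast
  define g where "g = f(m + 2 := p)"
  have dist: "distinct (1 # xs)" using xs by auto
  have "p \<in> set (1 # as)" unfolding pc by simp
  moreover have "set as \<subseteq> {2..m + 1}" using \<open>set (as @ bs) = {2..m+1}\<close> by auto
  ultimately have p: "p \<in> {1..<m + 2}" by auto
  have "p \<notin> set cs" using dist unfolding ab append_Cons[symmetric] pc by auto
  moreover have "attachment_word g m = cs @ p # bs"
  proof -
    have "attachment_word g m = attachment_word f m" by (rule attachment_word_cong) (simp add: g_def)
    also have "\<dots> = (1 # as) @ bs" using f(2) by simp
    finally show ?thesis unfolding pc by simp
  qed
  ultimately have "attachment_word g (Suc m) = 1 # xs"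
    unfolding ab append_Cons[symmetric] pc by (simp add: g_def insert_after_append)
  moreover have "\<forall>i\<in>{2..Suc m + 1}. g i \<in> {1..<i}"
  proof
    fix i assume i: "i \<in> {2..Suc m + 1}"
    show "g i \<in> {1..<i}"
    proof (cases "i = m + 2")
      case True
      then show ?thesis using p by (simp add: g_def)
    next
      case False
      then have "i \<in> {2..m + 1}" using i by auto
      then have "f i \<in> {1..<i}" using f(1) by blast
      then show ?thesis using False by (simp add: g_def)
    qed
  qed
  ultimately show ?case by blast
qed

lemma bij_betw_attachment_word:
  "bij_betw (\<lambda>f. tl (attachment_word f m)) (\<Pi>\<^sub>E i\<in>{2..m + 1}. {1..<i}) (permutations_of_set {2..m + 1})"
proof -
  let ?F = "\<Pi>\<^sub>E i\<in>{2..m + 1}. {1..<i}" and ?h = "\<lambda>f. tl (attachment_word f m)"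
  have fin: "finite ?F" by (intro finite_PiE) auto
  have img: "?h ` ?F = permutations_of_set {2..m + 1}"
  proof (intro equalityI subsetI)
    fix xs assume "xs \<in> ?h ` ?F"
    then obtain f where f: "f \<in> ?F" "xs = ?h f" by auto
    have "set (attachment_word f m) = {1..m + 1}" "distinct (attachment_word f m)"
      "hd (attachment_word f m) = 1" "attachment_word f m \<noteq> []"
      using attachment_word_props[of m f] PiE_mem[OF f(1)] by auto
    then have "attachment_word f m = 1 # xs" "set (1 # xs) = {1..m + 1}" "distinct (1 # xs)"
      unfolding f(2) by (metis list.collapse)+
    then have "distinct xs" and "set xs = {1..m + 1} - {1}" by (simp, metis distinct.simps(2) list.simps(15) Diff_insert_absorb)
    note this(2)
    also have "{1..m + 1} - {1} = {2..m + 1}" by auto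
    finally show "xs \<in> permutations_of_set {2..m + 1}"
      using \<open>distinct xs\<close> by (simp add: permutations_of_set_def)
  next
    fix xs assume "xs \<in> permutations_of_set {2..m + 1}"
    then obtain f where f: "\<forall>i\<in>{2..m + 1}. f i \<in> {1..<i}" "attachment_word f m = 1 # xs"
      using attachment_word_surj by blast
    have w: "attachment_word (restrict f {2..m + 1}) m = 1 # xs"
      using f(2) attachment_word_cong[of m "restrict f {2..m + 1}" f] by auto
    have "restrict f {2..m + 1} \<in> ?F" using f(1) by auto
    then show "xs \<in> ?h ` ?F" by (rule rev_image_eqI) (simp only: w list.sel)
  qed
  \<comment> \<open>Both sets have \<open>fact m\<close> elements, so that surjectivity yields injectivity.\<close>
  have "card ?F = fact m"
    using bij_betw_same_card[OF bij_betw_tree_of_parents[of "m + 1"]] card_increasing_trees[of "m + 1"]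
    by simp
  also have "\<dots> = card (permutations_of_set {2..m + 1})" by simp
  finally have "card ?F = card (permutations_of_set {2..m + 1})" .
  then show ?thesis
    unfolding bij_betw_def using img fin by (metis eq_card_imp_inj_on)
qed

lemma count_runs_1_Cons:
  assumes "set xs = {2..m + 1}" "distinct xs" "k \<le> m"
  shows "count_runs k (1 # xs) = Suc (count_runs k xs)"
proof -
  have run: "takeWhile ((<) (Suc 0)) xs = xs" unfolding takeWhile_eq_all_conv using assms by auto
  have "length xs = m" using assms distinct_card[of xs] by simp
  then show ?thesis using assms(3) by (simp add: run)
qed

text \<open>
  For \<open>k \<le> m\<close>, in the uniform recursive tree of order \<open>m + 1\<close>, the number of nodes with at least \<open>k\<close> descendants has
  the law of \<open>1 + count_runs k\<close> at a uniform permutation of \<open>{2..m + 1}\<close>. The extra \<open>1\<close> is the root.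
\<close>
lemma sum_increasing_trees:
  fixes h :: "nat \<Rightarrow> 'b :: comm_monoid_add"
  assumes "k \<le> m"
  shows "(\<Sum>T\<in>increasing_trees (m + 1). h (num_nodes_ge k (m + 1) T)) =
    (\<Sum>xs\<in>permutations_of_set {2..m + 1}. h (Suc (count_runs k xs)))"
proof -
  let ?F = "\<Pi>\<^sub>E i\<in>{2..m + 1}. {1..<i}"
  have "(\<Sum>T\<in>increasing_trees (m + 1). h (num_nodes_ge k (m + 1) T)) =
     (\<Sum>f\<in>?F. h (num_nodes_ge k (m + 1) (tree_of_parents (m + 1) f)))"
    by (rule sum.reindex_bij_betw[symmetric]) (rule bij_betw_tree_of_parents, simp)
  also have "\<dots> = (\<Sum>f\<in>?F. h (Suc (count_runs k (tl (attachment_word f m)))))"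
  proof (rule sum.cong[OF refl])
    fix f assume f: "f \<in> ?F"
    have w: "set (attachment_word f m) = {1..m + 1}" "distinct (attachment_word f m)"
      "hd (attachment_word f m) = 1" "attachment_word f m \<noteq> []"
      using attachment_word_props[of m f] PiE_mem[OF f] by auto
    have "tl (attachment_word f m) \<in> permutations_of_set {2..m + 1}"
      using bij_betw_attachment_word[of m] f unfolding bij_betw_def by blast
    then have "count_runs k (1 # tl (attachment_word f m)) = Suc (count_runs k (tl (attachment_word f m)))"
      by (intro count_runs_1_Cons[OF _ _ assms]) (auto simp: permutations_of_set_def)
    then show "h (num_nodes_ge k (m + 1) (tree_of_parents (m + 1) f)) = h (Suc (count_runs k (tl (attachment_word f m))))"
      using num_nodes_ge_eq_count_runs[of m f k] PiE_mem[OF f] w(3,4)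
      by (metis (no_types, lifting) list.collapse)
  qed
  also have "\<dots> = (\<Sum>xs\<in>permutations_of_set {2..m + 1}. h (Suc (count_runs k xs)))"
    by (rule sum.reindex_bij_betw) (rule bij_betw_attachment_word)
  finally show ?thesis .
qed

lemma ex_strict_mono_bij:
  fixes A :: "'a :: linorder set" and B :: "'b :: linorder set"
  assumes "finite A" "finite B" "card A = card B"
  shows "\<exists>g. strict_mono_on A g \<and> g ` A = B"
  using assms
proof (induction "card A" arbitrary: A B)
  case 0
  then show ?case by (auto simp: strict_mono_on_def)
next
  case (Suc n)
  then have ne: "A \<noteq> {}" "B \<noteq> {}" by (metis card.empty nat.distinct(1))+
  let ?a = "Max A" and ?b = "Max B"
  have ab: "?a \<in> A" "?b \<in> B" using Suc.prems ne by (simp_all add: Max_in)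
  have "card (A - {?a}) = n" "card (B - {?b}) = n"
    using Suc.hyps(2) Suc.prems ab by (simp_all add: card_Diff_singleton)
  then obtain g where g: "strict_mono_on (A - {?a}) g" "g ` (A - {?a}) = B - {?b}"
    using Suc.hyps(1)[of "A - {?a}" "B - {?b}"] Suc.prems(1,2) by (metis finite_Diff)
  have lt: "x < ?b" if "x \<in> B - {?b}" for x using that Suc.prems(2) by (simp add: less_le)
  have "strict_mono_on A (g(?a := ?b))"
  proof (rule strict_mono_onI)
    fix r s assume rs: "r \<in> A" "s \<in> A" "r < s"
    have "r \<noteq> ?a" using rs Suc.prems(1) by (metis Max_ge leD)
    moreover have "g r < ?b" using \<open>r \<noteq> ?a\<close> rs g(2) lt by blast
    ultimately show "(g(?a := ?b)) r < (g(?a := ?b)) s"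
      using rs g(1) by (auto simp: strict_mono_on_def)
  qed
  moreover have "(g(?a := ?b)) ` A = B"
  proof -
    have "(g(?a := ?b)) ` insert ?a (A - {?a}) = insert ?b (g ` (A - {?a}))" by auto
    then show ?thesis unfolding g(2) using ab by (simp add: insert_absorb)
  qed
  ultimately show ?case by blast
qed

lemma sum_permutations_inj_map:
  fixes F :: "'c list \<Rightarrow> 'b :: comm_monoid_add"
  assumes "inj_on g A"
  shows "(\<Sum>xs\<in>permutations_of_set (g ` A). F xs) = (\<Sum>xs\<in>permutations_of_set A. F (map g xs))"
proof (subst permutations_of_set_image_inj[OF assms], subst sum.reindex)
  have "xs = ys" if "set xs = A" "set ys = A" "map g xs = map g ys" for xs ys
    using that assms by (metis inj_on_map_eq_map sup.idem)
  then show "inj_on (map g) (permutations_of_set A)"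
    by (auto simp: inj_on_def permutations_of_set_def)
qed simp

text \<open>
  The statistic depends on the relative order of the letters only, so that its distribution over the
  arrangements of a finite set depends on the cardinality of that set alone.
\<close>
lemma sum_count_runs_permutations:
  fixes h :: "nat \<Rightarrow> 'c :: comm_monoid_add" and A :: "'a :: linorder set" and B :: "'b :: linorder set"
  assumes "finite A" "finite B" "card A = card B"
  shows "(\<Sum>xs\<in>permutations_of_set A. h (count_runs k xs)) = (\<Sum>xs\<in>permutations_of_set B. h (count_runs k xs))"
proof -
  obtain g where g: "strict_mono_on A g" "g ` A = B" using ex_strict_mono_bij[OF assms] by blast
  have "(\<Sum>xs\<in>permutations_of_set B. h (count_runs k xs)) =
      (\<Sum>xs\<in>permutations_of_set A. h (count_runs k (map g xs)))"
    unfolding g(2)[symmetric]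
    by (rule sum_permutations_inj_map) (rule strict_mono_on_imp_inj_on[OF g(1)])
  also have "\<dots> = (\<Sum>xs\<in>permutations_of_set A. h (count_runs k xs))"
    using g(1) by (intro sum.cong refl) (auto simp: permutations_of_set_def count_runs_map)
  finally show ?thesis by simp
qed

section \<open>The central limit theorem for stationary sequences of finite dependence range\<close>

lemma norm_iexp_diff_le: "norm (iexp a - iexp b) \<le> \<bar>a - b\<bar>"
proof -
  have "iexp a - iexp b = iexp b * (iexp (a - b) - 1)"
    by (simp add: algebra_simps exp_add[symmetric])
  also have "norm \<dots> = norm (iexp (a - b) - 1)" by (simp add: norm_mult)
  also have "\<dots> \<le> \<bar>a - b\<bar>" using iexp_approx1[of "a - b" 0] by simp
  finally show ?thesis .
qed

lemma (in prob_space) norm_char_diff_le: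
  assumes [simp]: "integrable M Z" "integrable M W"
  shows "norm (char (distr M borel Z) t - char (distr M borel W) t) \<le> \<bar>t\<bar> * expectation (\<lambda>\<omega>. \<bar>Z \<omega> - W \<omega>\<bar>)"
proof -
  have [measurable]: "random_variable borel Z" "random_variable borel W"
    using assms by (auto intro: borel_measurable_integrable)
  have int: "integrable M (\<lambda>\<omega>. iexp (t * V \<omega>))" if [measurable]: "random_variable borel V" for V
    by (rule integrable_const_bound[where B=1]) auto
  have "char (distr M borel Z) t - char (distr M borel W) t = (\<integral>\<omega>. iexp (t * Z \<omega>) - iexp (t * W \<omega>) \<partial>M)"
    unfolding char_def by (subst Bochner_Integration.integral_diff) (simp_all add: integral_distr int del: of_real_mult)
  also have "norm \<dots> \<le> (\<integral>\<omega>. \<bar>t\<bar> * \<bar>Z \<omega> - W \<omega>\<bar> \<partial>M)"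
  proof (rule order_trans[OF integral_norm_bound integral_mono])
    fix \<omega>
    have "norm (iexp (t * Z \<omega>) - iexp (t * W \<omega>)) \<le> \<bar>t * Z \<omega> - t * W \<omega>\<bar>" by (rule norm_iexp_diff_le)
    also have "\<dots> = \<bar>t\<bar> * \<bar>Z \<omega> - W \<omega>\<bar>" by (simp add: abs_mult right_diff_distrib[symmetric])
    finally show "norm (iexp (t * Z \<omega>) - iexp (t * W \<omega>)) \<le> \<bar>t\<bar> * \<bar>Z \<omega> - W \<omega>\<bar>" .
  qed (auto simp: int simp del: of_real_mult)
  finally show ?thesis by simp
qed

lemma (in prob_space) expectation_abs_le_sqrt:
  fixes X :: "'a \<Rightarrow> real"
  assumes [measurable]: "random_variable borel X" and sq: "integrable M (\<lambda>\<omega>. (X \<omega>)\<^sup>2)"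
  shows "expectation (\<lambda>\<omega>. \<bar>X \<omega>\<bar>) \<le> sqrt (expectation (\<lambda>\<omega>. (X \<omega>)\<^sup>2))"
proof -
  have "integrable M (\<lambda>\<omega>. \<bar>X \<omega>\<bar>)"
    using square_integrable_imp_integrable[OF _ sq] by simp
  then have "variance (\<lambda>\<omega>. \<bar>X \<omega>\<bar>) = expectation (\<lambda>\<omega>. (X \<omega>)\<^sup>2) - (expectation (\<lambda>\<omega>. \<bar>X \<omega>\<bar>))\<^sup>2"
    using sq by (subst variance_eq) auto
  with variance_positive[of "\<lambda>\<omega>. \<bar>X \<omega>\<bar>"] show ?thesis
    by (intro real_le_rsqrt) simp
qed

text \<open>
  If \<open>a\<close> is approximated, for each large \<open>B\<close>, by a sequence \<open>d B\<close> with the limit \<open>l\<close>, and if the asymptotic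
  error \<open>\<beta> B\<close> of that approximation vanishes as \<open>B\<close> grows, then \<open>a\<close> tends to \<open>l\<close>.
\<close>
lemma tendsto_by_approximation:
  fixes a :: "nat \<Rightarrow> 'a :: real_normed_vector"
  assumes approx: "\<forall>\<^sub>F B in sequentially.
      (\<forall>\<^sub>F N in sequentially. norm (a N - d B N) \<le> e B N) \<and> (d B \<longlongrightarrow> l) sequentially \<and> (e B \<longlongrightarrow> \<beta> B) sequentially"
    and \<beta>: "\<beta> \<longlonglongrightarrow> (0 :: real)"
  shows "a \<longlonglongrightarrow> l"
proof (rule tendstoI)
  fix \<epsilon> :: real assume "\<epsilon> > 0"
  have "\<forall>\<^sub>F B in sequentially. \<beta> B < \<epsilon> / 2" using \<beta> \<open>\<epsilon> > 0\<close> by (intro order_tendstoD) auto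
  with approx have "\<forall>\<^sub>F B in sequentially. (\<forall>\<^sub>F N in sequentially. norm (a N - d B N) \<le> e B N) \<and>
      (d B \<longlongrightarrow> l) sequentially \<and> (e B \<longlongrightarrow> \<beta> B) sequentially \<and> \<beta> B < \<epsilon> / 2"
    by eventually_elim auto
  then obtain B where B: "\<forall>\<^sub>F N in sequentially. norm (a N - d B N) \<le> e B N"
      "d B \<longlonglongrightarrow> l" "e B \<longlonglongrightarrow> \<beta> B" "\<beta> B < \<epsilon> / 2"
    using eventually_happens'[OF sequentially_bot] by blast
  have "\<forall>\<^sub>F N in sequentially. dist (d B N) l < \<epsilon> / 2" using B(2) \<open>\<epsilon> > 0\<close> by (intro tendstoD) auto
  moreover have "\<forall>\<^sub>F N in sequentially. e B N < \<epsilon> / 2" using B(3,4) by (rule order_tendstoD)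
  ultimately show "\<forall>\<^sub>F N in sequentially. dist (a N) l < \<epsilon>"
    using B(1)
  proof eventually_elim
    case (elim N)
    have "dist (a N) l \<le> dist (a N) (d B N) + dist (d B N) l" by (rule dist_triangle)
    then show ?case using elim by (simp add: dist_norm)
  qed
qed

lemma tendsto_div_nat_over:
  assumes "L > 0"
  shows "(\<lambda>N. real (N div L) / real N) \<longlonglongrightarrow> 1 / real L"
proof (rule tendsto_sandwich)
  show "\<forall>\<^sub>F N in sequentially. 1 / real L - 1 / real N \<le> real (N div L) / real N"
    using eventually_gt_at_top[of 0]
  proof eventually_elim
    case (elim N)
    have "N < (N div L + 1) * L" using assms by (metis Suc_eq_plus1 dividend_less_div_times mult_Suc add.commute mult.commute)
    then have "real N < (real (N div L) + 1) * real L"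
      by (metis of_nat_1 of_nat_add of_nat_less_iff of_nat_mult)
    then have "real N / real L - 1 \<le> real (N div L)" using assms by (simp add: field_simps)
    then have "(real N / real L - 1) / real N \<le> real (N div L) / real N"
      by (rule divide_right_mono) simp
    also have "(real N / real L - 1) / real N = 1 / real L - 1 / real N"
      using elim by (simp add: diff_divide_distrib)
    finally show ?case .
  qed
  show "\<forall>\<^sub>F N in sequentially. real (N div L) / real N \<le> 1 / real L"
    using eventually_gt_at_top[of 0]
  proof eventually_elim
    case (elim N)
    have "real (N div L) * real L \<le> real N"
      by (metis div_times_less_eq_dividend of_nat_le_iff of_nat_mult)
    then show ?case using elim assms by (simp add: field_simps)
  qed
  have "(\<lambda>N. 1 / real L - 1 / real N) \<longlonglongrightarrow> 1 / real L - 0"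
    by (intro tendsto_intros lim_1_over_n)
  then show "(\<lambda>N. 1 / real L - 1 / real N) \<longlonglongrightarrow> 1 / real L" by simp
qed auto

text \<open>
  Sum over the first \<open>B\<close> indices of each of \<open>m\<close> consecutive blocks of length \<open>L\<close>.
\<close>
lemma sum_over_blocks:
  fixes f :: "nat \<Rightarrow> 'b :: comm_monoid_add"
  assumes "B \<le> L" "L > 0"
  shows "(\<Sum>b<m. \<Sum>i<B. f (b * L + i)) = (\<Sum>n | n < m * L \<and> n mod L < B. f n)"
proof -
  have "(\<Sum>b<m. \<Sum>i<B. f (b * L + i)) = (\<Sum>(b, i)\<in>{..<m} \<times> {..<B}. f (b * L + i))"
    by (rule sum.cartesian_product)
  also have "\<dots> = (\<Sum>n | n < m * L \<and> n mod L < B. f n)"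
  proof (rule sum.reindex_bij_witness[where i="\<lambda>n. (n div L, n mod L)" and j="\<lambda>(b, i). b * L + i"])
    fix n assume "n \<in> {n. n < m * L \<and> n mod L < B}"
    then show "(n div L, n mod L) \<in> {..<m} \<times> {..<B}"
      by (auto simp: less_mult_imp_div_less)
  next
    fix p assume "p \<in> {..<m} \<times> {..<B}"
    then obtain b i where p: "p = (b, i)" "b < m" "i < B" by auto
    have "b * L + i < Suc b * L" using p assms by simp
    also have "\<dots> \<le> m * L" using p by (intro mult_right_mono) auto
    finally show "(case p of (b, i) \<Rightarrow> b * L + i) \<in> {n. n < m * L \<and> n mod L < B}"
      using p assms by simp
  qed (use assms in auto)
  finally show ?thesis .
qed

text \<open>
  A square integrable, centred sequence with stationary covariances \<open>c\<close> of range \<open>k\<close>. Beyond the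
  covariances, the dependence range and the stationarity are required of blocks only: the sums over blocks of \<open>B\<close> indices that are
  separated by gaps of length \<open>k\<close> are independent and identically distributed.
\<close>
locale stationary_m_dependent = prob_space M for M :: "'a measure" +
  fixes X :: "nat \<Rightarrow> 'a \<Rightarrow> real" and c :: "nat \<Rightarrow> real" and k :: nat
  assumes random_variable_X [measurable]: "random_variable borel (X i)"
    and square_integrable_X: "integrable M (\<lambda>\<omega>. (X i \<omega>)\<^sup>2)"
    and mean_X: "expectation (X i) = 0"
    and covariance_X: "expectation (\<lambda>\<omega>. X i \<omega> * X (i + d) \<omega>) = c d"
    and covariance_far: "d > k \<Longrightarrow> c d = 0"
    and indep_blocks: "indep_vars (\<lambda>_. borel) (\<lambda>b \<omega>. \<Sum>i<B. X (b * (B + k) + i) \<omega>) UNIV"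
    and distr_blocks: "distr M borel (\<lambda>\<omega>. \<Sum>i<B. X (b * (B + k) + i) \<omega>) = distr M borel (\<lambda>\<omega>. \<Sum>i<B. X i \<omega>)"
begin

text \<open>
  The limit of the variance of the \<open>N\<close>-th partial sum, divided by \<open>N\<close>.
\<close>
definition asymptotic_variance :: real where
  "asymptotic_variance = c 0 + 2 * (\<Sum>d\<in>{1..k}. c d)"

text \<open>
  The variance of the \<open>B\<close>-th partial sum, as the sequence is centred.
\<close>
definition sum_variance :: "nat \<Rightarrow> real" where
  "sum_variance B = expectation (\<lambda>\<omega>. (\<Sum>i<B. X i \<omega>)\<^sup>2)"

lemma integrable_prod [simp]: "integrable M (\<lambda>\<omega>. X i \<omega> * X j \<omega>)"
proof (rule Bochner_Integration.integrable_bound)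
  show "integrable M (\<lambda>\<omega>. (X i \<omega>)\<^sup>2 + (X j \<omega>)\<^sup>2)"
    using square_integrable_X by auto
  have "\<bar>x * y\<bar> \<le> x\<^sup>2 + y\<^sup>2" for x y :: real
  proof -
    have "2 * (\<bar>x\<bar> * \<bar>y\<bar>) \<le> x\<^sup>2 + y\<^sup>2" using sum_squares_bound[of "\<bar>x\<bar>" "\<bar>y\<bar>"] by simp
    moreover have "0 \<le> \<bar>x\<bar> * \<bar>y\<bar>" by simp
    ultimately show ?thesis unfolding abs_mult by linarith
  qed
  then show "AE \<omega> in M. norm (X i \<omega> * X j \<omega>) \<le> norm ((X i \<omega>)\<^sup>2 + (X j \<omega>)\<^sup>2)" by simp
qed measurable

lemma integrable_X [simp]: "integrable M (X i)"
  using square_integrable_imp_integrable[OF random_variable_X square_integrable_X] .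

lemma square_sum_X: "(\<Sum>i\<in>G. X i \<omega>)\<^sup>2 = (\<Sum>i\<in>G. \<Sum>j\<in>G. X i \<omega> * X j \<omega>)"
  by (simp add: power2_eq_square sum_product)

lemma integrable_square_sum [simp]: "integrable M (\<lambda>\<omega>. (\<Sum>i\<in>G. X i \<omega>)\<^sup>2)"
  unfolding square_sum_X by simp

lemma covariance_eq: "expectation (\<lambda>\<omega>. X i \<omega> * X j \<omega>) = c (if i \<le> j then j - i else i - j)"
  using covariance_X[of i "j - i"] covariance_X[of j "i - j"] by (auto simp: mult.commute)

lemma expectation_square_sum:
  "expectation (\<lambda>\<omega>. (\<Sum>i\<in>G. X i \<omega>)\<^sup>2) = (\<Sum>i\<in>G. \<Sum>j\<in>G. c (if i \<le> j then j - i else i - j))"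
  unfolding square_sum_X by (simp add: covariance_eq)

lemma abs_covariance_le: "\<bar>c d\<bar> \<le> c 0"
proof -
  have c0: "expectation (\<lambda>\<omega>. (X i \<omega>)\<^sup>2) = c 0" for i
    using covariance_X[of i 0] by (simp add: power2_eq_square)
  have "\<bar>c d\<bar> = \<bar>expectation (\<lambda>\<omega>. X 0 \<omega> * X d \<omega>)\<bar>" using covariance_X[of 0 d] by simp
  also have "\<dots> \<le> expectation (\<lambda>\<omega>. ((X 0 \<omega>)\<^sup>2 + (X d \<omega>)\<^sup>2) / 2)"
  proof (rule order_trans[OF integral_abs_bound integral_mono])
    fix \<omega>
    have "2 * (\<bar>X 0 \<omega>\<bar> * \<bar>X d \<omega>\<bar>) \<le> (X 0 \<omega>)\<^sup>2 + (X d \<omega>)\<^sup>2"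
      using sum_squares_bound[of "\<bar>X 0 \<omega>\<bar>" "\<bar>X d \<omega>\<bar>"] by simp
    then show "\<bar>X 0 \<omega> * X d \<omega>\<bar> \<le> ((X 0 \<omega>)\<^sup>2 + (X d \<omega>)\<^sup>2) / 2" by (simp add: abs_mult field_simps)
  qed (use square_integrable_X in auto)
  also have "\<dots> = c 0" using square_integrable_X by (simp add: c0)
  finally show ?thesis .
qed

lemma c0_nonneg: "c 0 \<ge> 0"
  using abs_covariance_le[of 0] by linarith

lemma expectation_square_sum_le:
  assumes "finite G"
  shows "expectation (\<lambda>\<omega>. (\<Sum>i\<in>G. X i \<omega>)\<^sup>2) \<le> real (card G) * (real (2 * k + 1) * c 0)"
proof -
  have "(\<Sum>j\<in>G. c (if i \<le> j then j - i else i - j)) \<le> real (2 * k + 1) * c 0" for i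
  proof -
    have "(\<Sum>j\<in>G. c (if i \<le> j then j - i else i - j)) \<le> (\<Sum>j\<in>G. if j \<in> {i - k..i + k} then c 0 else 0)"
    proof (rule sum_mono)
      fix j
      show "c (if i \<le> j then j - i else i - j) \<le> (if j \<in> {i - k..i + k} then c 0 else 0)"
        using abs_covariance_le[of "if i \<le> j then j - i else i - j"]
          covariance_far[of "if i \<le> j then j - i else i - j"] by (auto split: if_splits)
    qed
    also have "\<dots> = real (card (G \<inter> {i - k..i + k})) * c 0"
      using assms by (simp add: sum.If_cases Int_def)
    also have "\<dots> \<le> real (2 * k + 1) * c 0"
    proof (rule mult_right_mono[OF _ c0_nonneg])
      have "card (G \<inter> {i - k..i + k}) \<le> card {i - k..i + k}" by (intro card_mono) auto
      also have "\<dots> \<le> 2 * k + 1" by simp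
      finally show "real (card (G \<inter> {i - k..i + k})) \<le> real (2 * k + 1)" by linarith
    qed
    finally show ?thesis .
  qed
  then have "(\<Sum>i\<in>G. \<Sum>j\<in>G. c (if i \<le> j then j - i else i - j)) \<le> (\<Sum>i\<in>G. real (2 * k + 1) * c 0)"
    by (intro sum_mono)
  then show ?thesis by (simp add: expectation_square_sum)
qed

lemma sum_variance_Suc:
  "sum_variance (Suc B) = sum_variance B + c 0 + 2 * (\<Sum>d\<in>{1..B}. c d)"
proof -
  have "sum_variance (Suc B) = expectation (\<lambda>\<omega>. (\<Sum>i<B. X i \<omega>)\<^sup>2 + X B \<omega> * X B \<omega> + 2 * (\<Sum>i<B. X i \<omega> * X B \<omega>))"
    unfolding sum_variance_def
    by (intro Bochner_Integration.integral_cong refl)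
      (simp add: power2_eq_square algebra_simps sum_distrib_left)
  also have "\<dots> = sum_variance B + c 0 + 2 * (\<Sum>i<B. c (B - i))"
    by (simp add: sum_variance_def covariance_eq)
  also have "(\<Sum>i<B. c (B - i)) = (\<Sum>d\<in>{1..B}. c d)"
    by (rule sum.reindex_bij_witness[of _ "\<lambda>d. B - d" "\<lambda>i. B - i"]) auto
  finally show ?thesis .
qed

text \<open>
  From length \<open>k\<close> onwards, each further summand adds exactly the asymptotic variance.
\<close>
lemma sum_variance_add: "sum_variance (k + n) = sum_variance k + real n * asymptotic_variance"
proof (induction n)
  case (Suc n)
  have "(\<Sum>d\<in>{1..k + n}. c d) = (\<Sum>d\<in>{1..k}. c d)"
    by (rule sum.mono_neutral_right) (auto intro: covariance_far)
  then show ?case using Suc sum_variance_Suc[of "k + n"]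
    by (simp add: asymptotic_variance_def algebra_simps)
qed simp

lemma sum_variance_tendsto:
  "(\<lambda>B. sum_variance B / real (B + k)) \<longlonglongrightarrow> asymptotic_variance"
proof -
  let ?a = "sum_variance k - 2 * real k * asymptotic_variance"
  have "(\<lambda>B. asymptotic_variance + ?a / real (B + k)) \<longlonglongrightarrow> asymptotic_variance + 0"
  proof (intro tendsto_add tendsto_const)
    have "(\<lambda>B. ?a / real B) \<longlonglongrightarrow> 0" by (rule lim_const_over_n)
    then show "(\<lambda>B. ?a / real (B + k)) \<longlonglongrightarrow> 0" by (rule LIMSEQ_ignore_initial_segment)
  qed
  moreover have "\<forall>\<^sub>F B in sequentially. asymptotic_variance + ?a / real (B + k) = sum_variance B / real (B + k)"
    using eventually_gt_at_top[of k]
  proof eventually_elim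
    case (elim B)
    have "sum_variance B = sum_variance k + (real B - real k) * asymptotic_variance"
      using sum_variance_add[of "B - k"] elim by (simp add: of_nat_diff)
    then have "sum_variance B = asymptotic_variance * real (B + k) + ?a"
      by (simp add: algebra_simps)
    moreover have "real (B + k) \<noteq> 0" using elim by simp
    ultimately show ?case by (simp add: add_divide_distrib del: of_nat_add)
  qed
  ultimately show ?thesis by (simp add: tendsto_cong)
qed

text \<open>
  The distance in mean between the normalised partial sum of length \<open>N\<close> and the normalised sum over
  the \<open>N div L\<close> complete blocks. The first term bounds the summands in the gaps and in the incomplete
  last block, the second term the change of the normalisation.
\<close>
lemma block_approximation:
  assumes V: "sum_variance B > 0" and v: "asymptotic_variance > 0" and N: "N \<ge> B + k" "B > 0"
  defines "L \<equiv> B + k" and "K \<equiv> real (2 * k + 1) * c 0"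
  defines "m \<equiv> N div L"
  shows "expectation (\<lambda>\<omega>. \<bar>(\<Sum>i<N. X i \<omega>) / sqrt (real N * asymptotic_variance)
            - (\<Sum>b<m. \<Sum>i<B. X (b * L + i) \<omega>) / sqrt (real m * sum_variance B)\<bar>)
    \<le> sqrt ((real m / real N * real k + real L * (1 / real N)) * K / asymptotic_variance)
      + sqrt (real B * K / sum_variance B) * \<bar>sqrt (real m / real N * sum_variance B / asymptotic_variance) - 1\<bar>"
proof -
  \<comment> \<open>\<open>Q\<close> consists of the indices in complete blocks, \<open>G\<close> of the remaining ones.\<close>
  define Q where "Q = {n. n < m * L \<and> n mod L < B}"
  define G where "G = {..<N} - Q"
  define R where "R \<omega> = (\<Sum>i\<in>G. X i \<omega>)" for \<omega>
  define T where "T \<omega> = (\<Sum>i\<in>Q. X i \<omega>)" for \<omega>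
  define sN where "sN = sqrt (real N * asymptotic_variance)"
  define sM where "sM = sqrt (real m * sum_variance B)"
  have L: "L > 0" "B \<le> L" using N by (auto simp: L_def)
  have m: "m > 0" using N L by (simp add: m_def L_def div_greater_zero_iff)
  have mL: "m * L \<le> N" "N < m * L + L"
    using L by (simp_all add: m_def dividend_less_div_times add.commute)
  have K: "K \<ge> 0" using c0_nonneg by (simp add: K_def)
  have pos: "sN > 0" "sM > 0" using m V v N by (auto simp: sN_def sM_def)
  have "Q \<subseteq> {..<m * L}" by (auto simp: Q_def)
  then have Q: "finite Q" "Q \<subseteq> {..<N}" using mL(1) by (auto intro: finite_subset)
  have cardQ: "card Q = m * B"
    using sum_over_blocks[OF L(2,1), of "\<lambda>_. 1 :: nat" m] by (simp add: Q_def)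
  have "card G = N - m * B" using Q by (simp add: G_def card_Diff_subset cardQ)
  also have "\<dots> \<le> m * k + L" using mL(2) by (simp add: L_def algebra_simps)
  finally have cardG: "card G \<le> m * k + L" .
  have ER: "expectation (\<lambda>\<omega>. \<bar>R \<omega>\<bar>) \<le> sqrt (real (m * k + L) * K)"
  proof -
    have "expectation (\<lambda>\<omega>. \<bar>R \<omega>\<bar>) \<le> sqrt (expectation (\<lambda>\<omega>. (R \<omega>)\<^sup>2))"
      unfolding R_def by (rule expectation_abs_le_sqrt) simp_all
    also have "\<dots> \<le> sqrt (real (card G) * K)"
      unfolding R_def K_def by (intro real_sqrt_le_mono expectation_square_sum_le) (simp add: G_def)
    also have "\<dots> \<le> sqrt (real (m * k + L) * K)"
      using cardG K by (intro real_sqrt_le_mono mult_right_mono) (simp_all del: of_nat_add of_nat_mult)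
    finally show ?thesis .
  qed
  have ET: "expectation (\<lambda>\<omega>. \<bar>T \<omega>\<bar>) \<le> sqrt (real (m * B) * K)"
  proof -
    have "expectation (\<lambda>\<omega>. \<bar>T \<omega>\<bar>) \<le> sqrt (expectation (\<lambda>\<omega>. (T \<omega>)\<^sup>2))"
      unfolding T_def by (rule expectation_abs_le_sqrt) simp_all
    also have "\<dots> \<le> sqrt (real (m * B) * K)"
      unfolding T_def K_def cardQ[symmetric] using Q(1) by (intro real_sqrt_le_mono expectation_square_sum_le)
    finally show ?thesis .
  qed
  have int: "integrable M (\<lambda>\<omega>. \<bar>R \<omega>\<bar>)" "integrable M (\<lambda>\<omega>. \<bar>T \<omega>\<bar>)"
    by (simp_all add: R_def T_def)
  have T: "(\<Sum>b<m. \<Sum>i<B. X (b * L + i) \<omega>) = T \<omega>" for \<omega>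
    unfolding T_def Q_def by (rule sum_over_blocks[OF L(2,1)])
  have S: "(\<Sum>i<N. X i \<omega>) = R \<omega> + T \<omega>" for \<omega>
    unfolding R_def T_def G_def using Q by (simp add: sum.subset_diff)
  have "expectation (\<lambda>\<omega>. \<bar>(\<Sum>i<N. X i \<omega>) / sN - T \<omega> / sM\<bar>)
      \<le> expectation (\<lambda>\<omega>. \<bar>R \<omega>\<bar> / sN + \<bar>T \<omega>\<bar> / sM * \<bar>sM / sN - 1\<bar>)"
  proof (rule integral_mono)
    fix \<omega>
    have "(\<Sum>i<N. X i \<omega>) / sN - T \<omega> / sM = R \<omega> / sN + T \<omega> / sM * (sM / sN - 1)"
      unfolding S using pos by (simp add: field_simps)
    also have "\<bar>\<dots>\<bar> \<le> \<bar>R \<omega> / sN\<bar> + \<bar>T \<omega> / sM * (sM / sN - 1)\<bar>" by (rule abs_triangle_ineq)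
    also have "\<dots> = \<bar>R \<omega>\<bar> / sN + \<bar>T \<omega>\<bar> / sM * \<bar>sM / sN - 1\<bar>"
      using pos by (simp add: abs_mult)
    finally show "\<bar>(\<Sum>i<N. X i \<omega>) / sN - T \<omega> / sM\<bar> \<le> \<bar>R \<omega>\<bar> / sN + \<bar>T \<omega>\<bar> / sM * \<bar>sM / sN - 1\<bar>" .
  qed (use int in \<open>auto simp: T_def\<close>)
  also have "\<dots> = expectation (\<lambda>\<omega>. \<bar>R \<omega>\<bar>) / sN + expectation (\<lambda>\<omega>. \<bar>T \<omega>\<bar>) / sM * \<bar>sM / sN - 1\<bar>"
    using int by simp
  also have "\<dots> \<le> sqrt (real (m * k + L) * K) / sN + sqrt (real (m * B) * K) / sM * \<bar>sM / sN - 1\<bar>"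
    using ER ET pos by (intro add_mono mult_right_mono divide_right_mono) auto
  also have "sqrt (real (m * k + L) * K) / sN
      = sqrt ((real m / real N * real k + real L * (1 / real N)) * K / asymptotic_variance)"
    by (simp add: sN_def real_sqrt_divide[symmetric] add_divide_distrib distrib_right)
  also have "sqrt (real (m * B) * K) / sM = sqrt (real B * K / sum_variance B)"
    using m by (simp add: sM_def real_sqrt_divide[symmetric])
  also have "sM / sN = sqrt (real m / real N * sum_variance B / asymptotic_variance)"
    by (simp add: sM_def sN_def real_sqrt_divide[symmetric])
  finally show ?thesis by (simp only: T sN_def sM_def)
qed

theorem central_limit:
  assumes v: "asymptotic_variance > 0"
  shows "weak_conv_m (\<lambda>N. distr M borel (\<lambda>\<omega>. (\<Sum>i<N. X i \<omega>) / sqrt (real N * asymptotic_variance)))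
    std_normal_distribution"
proof (rule levy_continuity)
  fix t :: real
  define K where "K = real (2 * k + 1) * c 0"
  \<comment> \<open>The characteristic function of the normalised sum over the complete blocks, the bound on its distance
    from the one of the whole sum, and the limit of that bound as \<open>N\<close> grows.\<close>
  define d where "d B N = char (distr M borel (\<lambda>\<omega>. (\<Sum>b<N div (B + k). \<Sum>i<B. X (b * (B + k) + i) \<omega>)
      / sqrt (real (N div (B + k)) * sum_variance B))) t" for B N
  define e where "e B N = \<bar>t\<bar> * (sqrt ((real (N div (B + k)) / real N * real k + real (B + k) * (1 / real N)) * K / asymptotic_variance)
      + sqrt (real B * K / sum_variance B) * \<bar>sqrt (real (N div (B + k)) / real N * sum_variance B / asymptotic_variance) - 1\<bar>)" for B N
  define \<beta> where "\<beta> B = \<bar>t\<bar> * (sqrt (1 / real (B + k) * real k * K / asymptotic_variance)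
      + sqrt (real B / sum_variance B * K) * \<bar>sqrt (sum_variance B / real (B + k) / asymptotic_variance) - 1\<bar>)" for B
  have "\<forall>\<^sub>F B in sequentially. sum_variance B / real (B + k) > 0"
    using sum_variance_tendsto v by (rule order_tendstoD)
  then have V: "\<forall>\<^sub>F B in sequentially. sum_variance B > 0 \<and> B > 0"
    using eventually_gt_at_top[of 0] by eventually_elim (auto simp: zero_less_divide_iff)
  show "(\<lambda>N. char (distr M borel (\<lambda>\<omega>. (\<Sum>i<N. X i \<omega>) / sqrt (real N * asymptotic_variance))) t)
      \<longlonglongrightarrow> char std_normal_distribution t"
  proof (rule tendsto_by_approximation)
    show "\<forall>\<^sub>F B in sequentially.
      (\<forall>\<^sub>F N in sequentially.
         norm (char (distr M borel (\<lambda>\<omega>. (\<Sum>i<N. X i \<omega>) / sqrt (real N * asymptotic_variance))) t - d B N) \<le> e B N) \<and>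
      d B \<longlonglongrightarrow> char std_normal_distribution t \<and> e B \<longlonglongrightarrow> \<beta> B"
      using V
    proof eventually_elim
      case (elim B)
      then have VB: "sum_variance B > 0" and B: "B > 0" by auto
      have div_top: "filterlim (\<lambda>N. N div (B + k)) at_top sequentially"
      proof (rule filterlim_at_top[THEN iffD2], intro allI)
        fix Z :: nat
        show "\<forall>\<^sub>F N in sequentially. Z \<le> N div (B + k)"
          using eventually_ge_at_top[of "Z * (B + k)"]
          by eventually_elim (use B in \<open>simp add: less_eq_div_iff_mult_less_eq\<close>)
      qed
      have 1: "\<forall>\<^sub>F N in sequentially.
         norm (char (distr M borel (\<lambda>\<omega>. (\<Sum>i<N. X i \<omega>) / sqrt (real N * asymptotic_variance))) t - d B N) \<le> e B N"
        using eventually_ge_at_top[of "B + k"]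
      proof eventually_elim
        case (elim N)
        show ?case unfolding d_def e_def K_def
          by (rule order_trans[OF norm_char_diff_le mult_left_mono[OF block_approximation[OF VB v elim B]]])
            simp_all
      qed
      have 2: "d B \<longlonglongrightarrow> char std_normal_distribution t"
      proof -
        let ?Y = "\<lambda>b \<omega>. \<Sum>i<B. X (b * (B + k) + i) \<omega>"
        have mean: "expectation (?Y b) = 0" for b by (simp add: mean_X)
        have "(\<lambda>\<omega>. (?Y b \<omega>)\<^sup>2) = (\<lambda>\<omega>. (\<Sum>i\<in>(+) (b * (B + k)) ` {..<B}. X i \<omega>)\<^sup>2)" for b
          by (simp add: sum.reindex)
        then have int: "integrable M (\<lambda>\<omega>. (?Y b \<omega>)\<^sup>2)" for b by simp
        have var: "variance (?Y b) = (sqrt (sum_variance B))\<^sup>2" for b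
        proof -
          have "variance (?Y b) = expectation (\<lambda>\<omega>. (?Y b \<omega>)\<^sup>2)" unfolding mean by simp
          also have "\<dots> = (\<integral>x. x\<^sup>2 \<partial>distr M borel (?Y b))" by (subst integral_distr) auto
          also have "\<dots> = (\<integral>x. x\<^sup>2 \<partial>distr M borel (\<lambda>\<omega>. \<Sum>i<B. X i \<omega>))" by (simp only: distr_blocks)
          also have "\<dots> = sum_variance B" by (subst integral_distr) (auto simp: sum_variance_def)
          finally show ?thesis using VB by simp
        qed
        have "weak_conv_m (\<lambda>n. distr M borel (\<lambda>\<omega>. (\<Sum>b<n. ?Y b \<omega>) / sqrt (real n * (sqrt (sum_variance B))\<^sup>2)))
            std_normal_distribution"
          using indep_blocks mean _ int var distr_blocks
          by (rule central_limit_theorem_zero_mean) (use VB in simp)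
        then have "(\<lambda>n. char (distr M borel (\<lambda>\<omega>. (\<Sum>b<n. ?Y b \<omega>) / sqrt (real n * (sqrt (sum_variance B))\<^sup>2))) t)
            \<longlonglongrightarrow> char std_normal_distribution t"
          by (intro levy_continuity1 real_distribution_distr real_dist_normal_dist) simp_all
        from filterlim_compose[OF this div_top] show ?thesis
          using VB by (simp add: d_def[abs_def])
      qed
      have 3: "e B \<longlonglongrightarrow> \<beta> B"
      proof -
        have "e B \<longlonglongrightarrow> \<bar>t\<bar> * (sqrt ((1 / real (B + k) * real k + real (B + k) * 0) * K / asymptotic_variance)
            + sqrt (real B * K / sum_variance B) * \<bar>sqrt (1 / real (B + k) * sum_variance B / asymptotic_variance) - 1\<bar>)"
          unfolding e_def using B v by (intro tendsto_intros tendsto_div_nat_over lim_1_over_n) auto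
        then show ?thesis by (simp add: \<beta>_def)
      qed
      show ?case using 1 2 3 by blast
    qed
    have inv: "(\<lambda>B. 1 / real (B + k)) \<longlonglongrightarrow> 0"
      using LIMSEQ_ignore_initial_segment[OF lim_1_over_n[where 'a=real], of k] by simp
    have ratio: "(\<lambda>B. real B / sum_variance B) \<longlonglongrightarrow> 1 / asymptotic_variance"
    proof -
      have "(\<lambda>B. (1 - real k * (1 / real (B + k))) / (sum_variance B / real (B + k))) \<longlonglongrightarrow> (1 - real k * 0) / asymptotic_variance"
        using v by (intro tendsto_intros inv sum_variance_tendsto) simp
      moreover have "\<forall>\<^sub>F B in sequentially. (1 - real k * (1 / real (B + k))) / (sum_variance B / real (B + k)) = real B / sum_variance B"
        using V
      proof eventually_elim
        case (elim B)
        then have "1 - real k * (1 / real (B + k)) = real B / real (B + k)" by (simp add: field_simps)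
        then show ?case using elim by (simp del: of_nat_add)
      qed
      ultimately have "(\<lambda>B. real B / sum_variance B) \<longlonglongrightarrow> (1 - real k * 0) / asymptotic_variance"
        by (rule Lim_transform_eventually)
      then show ?thesis by simp
    qed
    have "\<beta> \<longlonglongrightarrow> \<bar>t\<bar> * (sqrt (0 * real k * K / asymptotic_variance)
        + sqrt (1 / asymptotic_variance * K) * \<bar>sqrt (asymptotic_variance / asymptotic_variance) - 1\<bar>)"
      unfolding \<beta>_def[abs_def] using v by (intro tendsto_intros inv ratio sum_variance_tendsto) auto
    then show "\<beta> \<longlonglongrightarrow> 0" using v by simp
  qed
next
  show "real_distribution (distr M borel (\<lambda>\<omega>. (\<Sum>i<N. X i \<omega>) / sqrt (real N * asymptotic_variance)))" for N
    by (rule real_distribution_distr) simp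
qed (rule real_dist_normal_dist)

text \<open>
  The central limit theorem with \<open>N + a\<close> in place of \<open>N\<close> in the normalisation.
\<close>
lemma central_limit_offset:
  assumes v: "asymptotic_variance > 0"
  shows "(\<lambda>N. char (distr M borel (\<lambda>\<omega>. (\<Sum>i<N. X i \<omega>) / sqrt (real (N + a) * asymptotic_variance))) t)
    \<longlonglongrightarrow> char std_normal_distribution t"
proof -
  define K where "K = real (2 * k + 1) * c 0"
  define r where "r N = 1 - sqrt (1 - real a * (1 / real (N + a)))" for N
  let ?Z = "\<lambda>N \<omega>. (\<Sum>i<N. X i \<omega>) / sqrt (real N * asymptotic_variance)"
  let ?W = "\<lambda>N \<omega>. (\<Sum>i<N. X i \<omega>) / sqrt (real (N + a) * asymptotic_variance)"
  have Z: "(\<lambda>N. char (distr M borel (?Z N)) t) \<longlonglongrightarrow> char std_normal_distribution t"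
    by (intro levy_continuity1 real_distribution_distr real_dist_normal_dist central_limit[OF v]) simp_all
  have "(\<lambda>N. char (distr M borel (?W N)) t - char (distr M borel (?Z N)) t) \<longlonglongrightarrow> 0"
  proof (rule Lim_null_comparison)
    show "\<forall>\<^sub>F N in sequentially. norm (char (distr M borel (?W N)) t - char (distr M borel (?Z N)) t)
        \<le> \<bar>t\<bar> * (sqrt (K / asymptotic_variance) * \<bar>r N\<bar>)"
      using eventually_gt_at_top[of 0]
    proof eventually_elim
      case (elim N)
      have r: "r N = 1 - sqrt (real N) / sqrt (real (N + a))"
        using elim by (simp add: r_def real_sqrt_divide[symmetric] field_simps)
      have "?W N \<omega> - ?Z N \<omega> = - (?Z N \<omega> * r N)" for \<omega>
      proof -
        have "S / (p * q) - S / (n * q) = - (S / (n * q) * (1 - n / p))"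
          if "p > 0" "q > 0" "n > 0" for S p q n :: real
          using that by (simp add: field_simps)
        from this[of "sqrt (real (N + a))" "sqrt asymptotic_variance" "sqrt (real N)" "\<Sum>i<N. X i \<omega>"]
        show ?thesis using elim v by (simp add: r real_sqrt_mult)
      qed
      then have "expectation (\<lambda>\<omega>. \<bar>?W N \<omega> - ?Z N \<omega>\<bar>)
          = expectation (\<lambda>\<omega>. \<bar>\<Sum>i<N. X i \<omega>\<bar>) / sqrt (real N * asymptotic_variance) * \<bar>r N\<bar>"
        using v by (simp add: abs_mult)
      also have "\<dots> \<le> sqrt (real N * K) / sqrt (real N * asymptotic_variance) * \<bar>r N\<bar>"
      proof (intro mult_right_mono divide_right_mono)
        have "expectation (\<lambda>\<omega>. \<bar>\<Sum>i<N. X i \<omega>\<bar>) \<le> sqrt (expectation (\<lambda>\<omega>. (\<Sum>i<N. X i \<omega>)\<^sup>2))"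
          by (rule expectation_abs_le_sqrt) simp_all
        also have "\<dots> \<le> sqrt (real N * K)"
          using expectation_square_sum_le[of "{..<N}"] by (simp add: K_def)
        finally show "expectation (\<lambda>\<omega>. \<bar>\<Sum>i<N. X i \<omega>\<bar>) \<le> sqrt (real N * K)" .
      qed (use v in auto)
      also have "sqrt (real N * K) / sqrt (real N * asymptotic_variance) = sqrt (K / asymptotic_variance)"
        using elim by (simp add: real_sqrt_divide[symmetric])
      finally have "expectation (\<lambda>\<omega>. \<bar>?W N \<omega> - ?Z N \<omega>\<bar>) \<le> sqrt (K / asymptotic_variance) * \<bar>r N\<bar>" .
      then show ?case
        by (intro order_trans[OF norm_char_diff_le mult_left_mono]) simp_all
    qed
    have inv: "(\<lambda>N. 1 / real (N + a)) \<longlonglongrightarrow> 0"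
      using LIMSEQ_ignore_initial_segment[OF lim_1_over_n[where 'a=real], of a] by simp
    have "(\<lambda>N. \<bar>t\<bar> * (sqrt (K / asymptotic_variance) * \<bar>r N\<bar>))
        \<longlonglongrightarrow> \<bar>t\<bar> * (sqrt (K / asymptotic_variance) * \<bar>1 - sqrt (1 - real a * 0)\<bar>)"
      unfolding r_def by (intro tendsto_intros inv)
    then show "(\<lambda>N. \<bar>t\<bar> * (sqrt (K / asymptotic_variance) * \<bar>r N\<bar>)) \<longlonglongrightarrow> 0" by simp
  qed
  from tendsto_add[OF this Z] show ?thesis by simp
qed

end

section \<open>Independent coordinates and exchangeability\<close>

text \<open>
  The canonical sequence of independent random variables with law \<open>D\<close>: the coordinates on the infinite
  product space.
\<close>
locale iid_sequence =
  fixes D :: "'a measure"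
  assumes prob_space_D: "prob_space D"
begin

abbreviation seq_space :: "(nat \<Rightarrow> 'a) measure" where
  "seq_space \<equiv> PiM UNIV (\<lambda>_. D)"

sublocale prob_space seq_space
  by (rule prob_space_PiM) (rule prob_space_D)

lemma measurable_reindex [measurable]:
  "(\<lambda>\<omega>. \<lambda>i\<in>I. \<omega> (f i)) \<in> measurable seq_space (PiM I (\<lambda>_. D))"
  by (intro measurable_restrict) measurable

lemma distr_reindex:
  "inj_on f I \<Longrightarrow> distr seq_space (PiM I (\<lambda>_. D)) (\<lambda>\<omega>. \<lambda>i\<in>I. \<omega> (f i)) = PiM I (\<lambda>_. D)"
  using distr_PiM_reindex[of UNIV "\<lambda>_. D" f I] prob_space_D by simp

text \<open>
  Any two families of distinct coordinates with the same index set have the same joint law. This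
  covers both exchangeability and stationarity.
\<close>
lemma expectation_reindex:
  fixes G :: "_ \<Rightarrow> 'b :: {banach, second_countable_topology}"
  assumes "inj_on f I" "inj_on g I" and [measurable]: "G \<in> borel_measurable (PiM I (\<lambda>_. D))"
  shows "(\<integral>\<omega>. G (\<lambda>i\<in>I. \<omega> (f i)) \<partial>seq_space) = (\<integral>\<omega>. G (\<lambda>i\<in>I. \<omega> (g i)) \<partial>seq_space)"
proof -
  have "(\<integral>\<omega>. G (\<lambda>i\<in>I. \<omega> (h i)) \<partial>seq_space) = (\<integral>x. G x \<partial>PiM I (\<lambda>_. D))" if "inj_on h I" for h
    by (subst distr_reindex[OF that, symmetric], subst integral_distr) simp_all
  then show ?thesis using assms by simp
qed

lemma indep_vars_coordinates: "indep_vars (\<lambda>_. D) (\<lambda>i \<omega>. \<omega> i) UNIV"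
proof (subst indep_vars_iff_distr_eq_PiM)
  have "distr seq_space D (\<lambda>\<omega>. \<omega> i) = D" for i
    using distr_PiM_component[of UNIV "\<lambda>_. D" i] prob_space_D by simp
  then show "distr seq_space seq_space (\<lambda>x. \<lambda>i\<in>UNIV. x i) =
      (\<Pi>\<^sub>M i\<in>UNIV. distr seq_space D (\<lambda>\<omega>. \<omega> i))"
    by (simp add: distr_id2 restrict_UNIV)
qed auto

end

text \<open>
  A real law without atoms: almost surely, no two coordinates are equal.
\<close>
locale atomless_iid_sequence = iid_sequence D for D :: "real measure" +
  assumes sets_D [measurable_cong, simp]: "sets D = sets borel"
    and atomless: "emeasure D {x} = 0"
begin

lemma space_D [simp]: "space D = UNIV"
  using sets_eq_imp_space_eq[OF sets_D] by simp

lemma space_seq_space [simp]: "space seq_space = UNIV"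
  by (simp add: space_PiM PiE_UNIV_domain)

lemma AE_coordinates_neq:
  assumes "i \<noteq> j"
  shows "AE \<omega> in seq_space. \<omega> i \<noteq> \<omega> j"
proof -
  interpret D: prob_space D by (rule prob_space_D)
  have "indep_var (PiM {i} (\<lambda>_. D)) (\<lambda>\<omega>. restrict (\<lambda>i. \<omega> i) {i}) (PiM {j} (\<lambda>_. D)) (\<lambda>\<omega>. restrict (\<lambda>i. \<omega> i) {j})"
    using assms by (intro indep_var_restrict[OF indep_vars_coordinates]) auto
  then have "indep_var D ((\<lambda>x. x i) \<circ> (\<lambda>\<omega>. restrict (\<lambda>i. \<omega> i) {i})) D ((\<lambda>x. x j) \<circ> (\<lambda>\<omega>. restrict (\<lambda>i. \<omega> i) {j}))"
    by (rule indep_var_compose) auto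
  then have indep: "indep_var D (\<lambda>\<omega>. \<omega> i) D (\<lambda>\<omega>. \<omega> j)" by (simp add: comp_def)
  have comp: "distr seq_space D (\<lambda>\<omega>. \<omega> i) = D" for i
    using distr_PiM_component[of UNIV "\<lambda>_. D" i] prob_space_D by simp
  have pair: "distr seq_space (D \<Otimes>\<^sub>M D) (\<lambda>\<omega>. (\<omega> i, \<omega> j)) = D \<Otimes>\<^sub>M D"
    using indep_var_distribution_eq[THEN iffD1, OF indep] by (simp add: comp)
  have diag: "{p \<in> space (D \<Otimes>\<^sub>M D). fst p = snd p} \<in> sets (D \<Otimes>\<^sub>M D)"
    by measurable
  have "emeasure (D \<Otimes>\<^sub>M D) {p \<in> space (D \<Otimes>\<^sub>M D). fst p = snd p} =
      (\<integral>\<^sup>+x. emeasure D (Pair x -` {p \<in> space (D \<Otimes>\<^sub>M D). fst p = snd p}) \<partial>D)"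
    by (rule D.emeasure_pair_measure_alt[OF diag])
  also have "(\<lambda>x. Pair x -` {p \<in> space (D \<Otimes>\<^sub>M D). fst p = snd p}) = (\<lambda>x. {x})"
    by (auto simp: space_pair_measure)
  finally have "emeasure (D \<Otimes>\<^sub>M D) {p \<in> space (D \<Otimes>\<^sub>M D). fst p = snd p} = 0"
    by (simp add: atomless)
  then have "AE p in D \<Otimes>\<^sub>M D. fst p \<noteq> snd p"
    using diag by (subst AE_iff_measurable[OF _ refl]) auto
  then have "AE p in distr seq_space (D \<Otimes>\<^sub>M D) (\<lambda>\<omega>. (\<omega> i, \<omega> j)). fst p \<noteq> snd p"
    unfolding pair .
  then show ?thesis
    using AE_distrD[of "\<lambda>\<omega>. (\<omega> i, \<omega> j)" seq_space "D \<Otimes>\<^sub>M D" "\<lambda>p. fst p \<noteq> snd p"] by simp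
qed

lemma AE_inj: "AE \<omega> in seq_space. inj \<omega>"
proof -
  have "AE \<omega> in seq_space. \<forall>i j. i \<noteq> j \<longrightarrow> \<omega> i \<noteq> \<omega> j"
    unfolding AE_all_countable using AE_coordinates_neq by auto
  then show ?thesis by eventually_elim (auto simp: inj_def)
qed

lemma sets_minimum [measurable]:
  "finite T \<Longrightarrow> {\<omega>. \<forall>j\<in>T. \<omega> b < \<omega> j} \<in> sets seq_space"
proof -
  assume [measurable]: "finite T"
  have "{\<omega> \<in> space seq_space. \<forall>j\<in>T. \<omega> b < \<omega> j} \<in> sets seq_space" by measurable
  then show ?thesis by simp
qed

text \<open>
  By exchangeability, each coordinate in \<open>T\<close> is equally likely to be the smallest one, even on an event
  that is symmetric in the coordinates in \<open>T\<close>.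
\<close>
lemma prob_minimum:
  assumes T: "finite T" "b \<in> T" and F [measurable]: "F \<in> sets seq_space"
    and inv: "\<And>i j \<omega>. i \<in> T \<Longrightarrow> j \<in> T \<Longrightarrow> \<omega> \<in> F \<longleftrightarrow> \<omega> \<circ> Transposition.transpose i j \<in> F"
  shows "prob (F \<inter> {\<omega>. \<forall>j\<in>T - {b}. \<omega> b < \<omega> j}) = prob F / card T"
proof -
  \<comment> \<open>The events \<open>E c\<close> for \<open>c\<close> in \<open>T\<close> are equally likely, pairwise disjoint, and cover \<open>F\<close> almost surely.\<close>
  define E where "E b = F \<inter> {\<omega>. \<forall>j\<in>T - {b}. \<omega> b < \<omega> j}" for b
  have E [measurable]: "E b \<in> sets seq_space" for b
    unfolding E_def using T by (intro sets.Int F sets_minimum) auto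
  have eq: "prob (E c) = prob (E b)" if c: "c \<in> T" for c
  proof -
    let ?\<tau> = "Transposition.transpose b c"
    have inj: "inj ?\<tau>" by simp
    have "prob (E b) = measure (distr seq_space seq_space (\<lambda>\<omega>. \<omega> \<circ> ?\<tau>)) (E b)"
      using distr_reindex[OF inj] by (simp add: restrict_UNIV comp_def)
    also have "\<dots> = prob ((\<lambda>\<omega>. \<omega> \<circ> ?\<tau>) -` E b \<inter> space seq_space)"
      using measurable_reindex[of ?\<tau> UNIV] by (intro measure_distr) (auto simp: restrict_UNIV comp_def)
    also have "(\<lambda>\<omega>. \<omega> \<circ> ?\<tau>) -` E b \<inter> space seq_space = E c"
    proof -
      have "(\<forall>j\<in>T - {b}. \<omega> (?\<tau> b) < \<omega> (?\<tau> j)) \<longleftrightarrow> (\<forall>j\<in>T - {c}. \<omega> c < \<omega> j)" for \<omega> :: "nat \<Rightarrow> real"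
      proof -
        have "?\<tau> ` (T - {b}) = T - {c}"
          using T c by (auto simp: image_iff Transposition.transpose_def)
        then have "(\<forall>j\<in>T - {c}. \<omega> c < \<omega> j) \<longleftrightarrow> (\<forall>j\<in>?\<tau> ` (T - {b}). \<omega> c < \<omega> j)" by simp
        then show ?thesis by simp
      qed
      then show ?thesis unfolding E_def using inv[OF T(2) c] by auto
    qed
    finally show ?thesis ..
  qed
  have "AE \<omega> in seq_space. \<omega> \<in> (\<Union>c\<in>T. E c) \<longleftrightarrow> \<omega> \<in> F"
    using AE_inj
  proof eventually_elim
    case (elim \<omega>)
    have "\<exists>c\<in>T. \<forall>j\<in>T - {c}. \<omega> c < \<omega> j"
    proof -
      have "Min (\<omega> ` T) \<in> \<omega> ` T" using T by (intro Min_in) auto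
      then obtain c where c: "c \<in> T" "\<omega> c = Min (\<omega> ` T)" by auto
      have "\<omega> c < \<omega> j" if "j \<in> T - {c}" for j
      proof -
        have "\<omega> c \<le> \<omega> j" using c T that by auto
        moreover have "\<omega> c \<noteq> \<omega> j" using elim that by (auto dest: injD)
        ultimately show ?thesis by simp
      qed
      then show ?thesis using c by blast
    qed
    then show ?case unfolding E_def by auto
  qed
  then have "prob F = prob (\<Union>c\<in>T. E c)"
    using T by (intro finite_measure_eq_AE) auto
  also have "\<dots> = (\<Sum>c\<in>T. prob (E c))"
  proof (rule finite_measure_finite_Union)
    have False if "\<omega> \<in> E c" "\<omega> \<in> E d" "c \<in> T" "d \<in> T" "c \<noteq> d" for \<omega> c d
    proof -
      have "\<omega> c < \<omega> d" "\<omega> d < \<omega> c" using that by (auto simp: E_def)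
      then show False by simp
    qed
    then show "disjoint_family_on E T" unfolding disjoint_family_on_def by blast
  qed (use T E in auto)
  also have "\<dots> = card T * prob (E b)" using eq by simp
  finally have "prob F = card T * prob (E b)" .
  moreover have "card T > 0" using T by (auto simp: card_gt_0_iff)
  ultimately show ?thesis unfolding E_def by simp
qed

end

context iid_sequence
begin

lemma measurable_restrict_PiM:
  "f ` I \<subseteq> K \<Longrightarrow> (\<lambda>x. \<lambda>i\<in>I. x (f i)) \<in> measurable (PiM K (\<lambda>_. D)) (PiM I (\<lambda>_. D))"
  by (intro measurable_restrict measurable_component_singleton) auto

text \<open>
  A function \<open>g\<close> of a moving window of length \<open>k + 1\<close> satisfies the hypotheses of the central limit
  theorem: windows at a distance larger than \<open>k\<close> use disjoint coordinates, and a block of \<open>B\<close> windows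
  uses \<open>B + k\<close> consecutive coordinates.
\<close>
lemma stationary_m_dependent_window:
  fixes g :: "(nat \<Rightarrow> 'a) \<Rightarrow> real" and k :: nat
  defines "X \<equiv> \<lambda>i \<omega>. g (\<lambda>j\<in>{..k}. \<omega> (i + j))"
  assumes g [measurable]: "g \<in> borel_measurable (PiM {..k} (\<lambda>_. D))"
    and sq: "integrable seq_space (\<lambda>\<omega>. (X 0 \<omega>)\<^sup>2)" and mean: "expectation (X 0) = 0"
  shows "stationary_m_dependent seq_space X (\<lambda>d. expectation (\<lambda>\<omega>. X 0 \<omega> * X d \<omega>)) k"
proof (unfold_locales)
  have inj: "inj_on ((+) i) I" for i :: nat and I by simp
  have inj0: "inj_on (\<lambda>j::nat. j) I" for I by simp
  show [measurable]: "X i \<in> borel_measurable seq_space" for i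
    unfolding X_def by (rule measurable_compose[OF measurable_reindex g])
  show "integrable seq_space (\<lambda>\<omega>. (X i \<omega>)\<^sup>2)" for i
  proof -
    have "integrable (PiM {..k} (\<lambda>_. D)) (\<lambda>x. (g x)\<^sup>2) \<longleftrightarrow> integrable seq_space (\<lambda>\<omega>. (X i \<omega>)\<^sup>2)" for i
      unfolding X_def by (subst distr_reindex[OF inj[of i], symmetric], subst integrable_distr_eq) simp_all
    with sq show ?thesis by blast
  qed
  show "expectation (X i) = 0" for i
    using expectation_reindex[OF inj[of i] inj[of 0] g] mean by (simp add: X_def)
  show "expectation (\<lambda>\<omega>. X i \<omega> * X (i + d) \<omega>) = expectation (\<lambda>\<omega>. X 0 \<omega> * X d \<omega>)" for i d
  proof -
    let ?I = "{..d + k}"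
    define H where "H x = g (\<lambda>j\<in>{..k}. x j) * g (\<lambda>j\<in>{..k}. x (d + j))" for x
    have "H \<in> borel_measurable (PiM ?I (\<lambda>_. D))"
      unfolding H_def
      by (intro borel_measurable_times measurable_compose[OF measurable_restrict_PiM g]) auto
    from expectation_reindex[OF inj[of i] inj[of 0] this]
    have "expectation (\<lambda>\<omega>. H (\<lambda>j\<in>?I. \<omega> (i + j))) = expectation (\<lambda>\<omega>. H (\<lambda>j\<in>?I. \<omega> (0 + j)))" .
    moreover have eq: "H (\<lambda>j\<in>?I. \<omega> (i + j)) = X i \<omega> * X (i + d) \<omega>" for i \<omega>
    proof -
      have "(\<lambda>j\<in>{..k}. (\<lambda>j\<in>?I. \<omega> (i + j)) j) = (\<lambda>j\<in>{..k}. \<omega> (i + j))"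
        "(\<lambda>j\<in>{..k}. (\<lambda>j\<in>?I. \<omega> (i + j)) (d + j)) = (\<lambda>j\<in>{..k}. \<omega> (i + d + j))"
        by (auto simp: fun_eq_iff add.assoc)
      then show ?thesis by (simp only: H_def X_def)
    qed
    ultimately show ?thesis unfolding eq by simp
  qed
  show "expectation (\<lambda>\<omega>. X 0 \<omega> * X d \<omega>) = 0" if d: "k < d" for d
  proof -
    let ?A = "{..k}" and ?B = "{d..d + k}"
    have "indep_var (PiM ?A (\<lambda>_. D)) (\<lambda>\<omega>. \<lambda>i\<in>?A. \<omega> i) (PiM ?B (\<lambda>_. D)) (\<lambda>\<omega>. \<lambda>i\<in>?B. \<omega> i)"
      using d by (intro indep_var_restrict[OF indep_vars_coordinates]) auto
    then have "indep_var borel (g \<circ> (\<lambda>\<omega>. \<lambda>i\<in>?A. \<omega> i)) borel ((\<lambda>x. g (\<lambda>j\<in>{..k}. x (d + j))) \<circ> (\<lambda>\<omega>. \<lambda>i\<in>?B. \<omega> i))"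
      by (rule indep_var_compose) (auto intro!: measurable_compose[OF measurable_restrict_PiM g])
    moreover have "(\<lambda>j\<in>{..k}. (\<lambda>i\<in>?B. \<omega> i) (d + j)) = (\<lambda>j\<in>{..k}. \<omega> (d + j))" for \<omega> :: "nat \<Rightarrow> 'a"
      by (auto simp: fun_eq_iff)
    ultimately have indep: "indep_var borel (X 0) borel (X d)"
      by (simp add: X_def comp_def)
    have int: "integrable seq_space (X i)" for i
      using \<open>\<And>i. integrable seq_space (\<lambda>\<omega>. (X i \<omega>)\<^sup>2)\<close>
      by (rule square_integrable_imp_integrable[rotated]) measurable
    show ?thesis
      using indep_var_lebesgue_integral[OF indep int int] mean by simp
  qed
  show "indep_vars (\<lambda>_. borel) (\<lambda>b \<omega>. \<Sum>i<B. X (b * (B + k) + i) \<omega>) UNIV" for B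
  proof -
    let ?L = "B + k"
    let ?K = "\<lambda>b. {b * ?L..<b * ?L + ?L}"
    have "disjoint_family_on ?K UNIV"
    proof (unfold disjoint_family_on_def, intro ballI impI)
      fix b b' :: nat assume "b \<noteq> b'"
      have "x div ?L = b" if "x \<in> ?K b" for x b
      proof -
        have "x = b * ?L + (x - b * ?L)" "x - b * ?L < ?L" using that by auto
        then show ?thesis by (metis div_mult_self3 div_less add.commute add.right_neutral gr_implies_not0)
      qed
      with \<open>b \<noteq> b'\<close> show "?K b \<inter> ?K b' = {}" by blast
    qed
    then have "indep_vars (\<lambda>b. PiM (?K b) (\<lambda>_. D)) (\<lambda>b \<omega>. \<lambda>i\<in>?K b. \<omega> i) UNIV"
      by (intro indep_vars_restrict[OF indep_vars_coordinates]) auto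
    then have "indep_vars (\<lambda>_. borel) (\<lambda>b \<omega>. (\<lambda>x. \<Sum>i<B. g (\<lambda>j\<in>{..k}. x (b * ?L + i + j))) (\<lambda>i\<in>?K b. \<omega> i)) UNIV"
    proof (rule indep_vars_compose2)
      fix b
      show "(\<lambda>x. \<Sum>i<B. g (\<lambda>j\<in>{..k}. x (b * ?L + i + j))) \<in> borel_measurable (PiM (?K b) (\<lambda>_. D))"
        by (intro borel_measurable_sum measurable_compose[OF measurable_restrict_PiM g]) auto
    qed
    also have "(\<lambda>b \<omega>. (\<lambda>x. \<Sum>i<B. g (\<lambda>j\<in>{..k}. x (b * ?L + i + j))) (\<lambda>i\<in>?K b. \<omega> i)) =
        (\<lambda>b \<omega>. \<Sum>i<B. X (b * ?L + i) \<omega>)"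
    proof (intro ext sum.cong refl)
      fix b i and \<omega> :: "nat \<Rightarrow> 'a" assume "i \<in> {..<B}"
      then have "(\<lambda>j\<in>{..k}. (\<lambda>i\<in>?K b. \<omega> i) (b * ?L + i + j)) = (\<lambda>j\<in>{..k}. \<omega> (b * ?L + i + j))"
        by (auto simp: fun_eq_iff)
      then show "g (\<lambda>j\<in>{..k}. (\<lambda>i\<in>?K b. \<omega> i) (b * ?L + i + j)) = X (b * ?L + i) \<omega>"
        by (simp only: X_def)
    qed
    finally show ?thesis .
  qed
  show "distr seq_space borel (\<lambda>\<omega>. \<Sum>i<B. X (b * (B + k) + i) \<omega>) = distr seq_space borel (\<lambda>\<omega>. \<Sum>i<B. X i \<omega>)" for B b
  proof -
    let ?I = "{..<B + k}"
    define H where "H x = (\<Sum>i<B. g (\<lambda>j\<in>{..k}. x (i + j)))" for x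
    have H [measurable]: "H \<in> borel_measurable (PiM ?I (\<lambda>_. D))"
      unfolding H_def
      by (intro borel_measurable_sum measurable_compose[OF measurable_restrict_PiM g]) auto
    have "distr seq_space borel (\<lambda>\<omega>. \<Sum>i<B. X (a + i) \<omega>) = distr (PiM ?I (\<lambda>_. D)) borel H" for a
    proof -
      have "distr (PiM ?I (\<lambda>_. D)) borel H =
          distr (distr seq_space (PiM ?I (\<lambda>_. D)) (\<lambda>\<omega>. \<lambda>j\<in>?I. \<omega> (a + j))) borel H"
        by (simp only: distr_reindex[OF inj])
      also have "\<dots> = distr seq_space borel (H \<circ> (\<lambda>\<omega>. \<lambda>j\<in>?I. \<omega> (a + j)))"
        by (rule distr_distr) simp_all
      also have "H \<circ> (\<lambda>\<omega>. \<lambda>j\<in>?I. \<omega> (a + j)) = (\<lambda>\<omega>. \<Sum>i<B. X (a + i) \<omega>)"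
        unfolding H_def comp_def
      proof (intro ext sum.cong refl)
        fix i and \<omega> :: "nat \<Rightarrow> 'a" assume "i \<in> {..<B}"
        then have "(\<lambda>j\<in>{..k}. (\<lambda>j\<in>?I. \<omega> (a + j)) (i + j)) = (\<lambda>j\<in>{..k}. \<omega> (a + i + j))"
          by (auto simp: fun_eq_iff add.assoc)
        then show "g (\<lambda>j\<in>{..k}. (\<lambda>j\<in>?I. \<omega> (a + j)) (i + j)) = X (a + i) \<omega>"
          by (simp only: X_def)
      qed
      finally show ?thesis ..
    qed
    from this[of "b * (B + k)"] this[of 0] show ?thesis by simp
  qed
qed

end

section \<open>Local minima in a sequence of independent variables\<close>

lemma harm_add_diff: "harm (m + n) - harm m = (\<Sum>d\<in>{1..n}. 1 / real (m + d))"
  by (induction n) (simp_all add: harm_Suc inverse_eq_divide algebra_simps)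

text \<open>
  Positivity follows from the bound by \<open>1 / (2 * k + 1)\<close> from below of each of the \<open>k\<close> summands of
  \<open>harm (2 * k + 1) - harm (k + 1)\<close>.
\<close>
lemma limiting_variance_pos:
  assumes "k \<ge> 1"
  shows "1 / real (k + 1) + (2 * harm (2 * k + 1) - 2 * harm (k + 1)) / real (k + 1)
           - real (2 * k + 1) / real (k + 1) ^ 2 > 0"
proof -
  have "harm (2 * k + 1) - harm (k + 1) = (\<Sum>d\<in>{1..k}. 1 / real (k + 1 + d))"
    using harm_add_diff[of "k + 1" k] by (simp add: mult_2)
  also have "\<dots> \<ge> (\<Sum>d\<in>{1..k}. 1 / real (2 * k + 1))"
    by (intro sum_mono divide_left_mono) auto
  finally have "harm (2 * k + 1) - harm (k + 1) \<ge> real k / real (2 * k + 1)" by simp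
  moreover have "real k / real (2 * k + 1) > real k / (2 * real (k + 1))"
    using assms by (intro divide_strict_left_mono) auto
  moreover have "real k / real (k + 1) = 2 * (real k / (2 * real (k + 1)))" by (simp add: field_simps)
  moreover have "0 < 2 * x - z" if "y \<le> x" "w < y" "z = 2 * w" for w x y z :: real
    using that by linarith
  ultimately have "0 < 2 * (harm (2 * k + 1) - harm (k + 1)) - real k / real (k + 1)"
    by blast
  then have "0 < (2 * (harm (2 * k + 1) - harm (k + 1)) - real k / real (k + 1)) / real (k + 1)"
    by (rule divide_pos_pos) simp
  also have "\<dots> = 1 / real (k + 1) + (2 * harm (2 * k + 1) - 2 * harm (k + 1)) / real (k + 1)
           - real (2 * k + 1) / real (k + 1) ^ 2"
  proof -
    have "(2 * x - k / q) / q = 1 / q + 2 * x / q - (k + q) / q ^ 2" if "q > 0" for x k q :: real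
      using that by (simp add: field_simps power2_eq_square)
    from this[of "real (k + 1)" "harm (2 * k + 1) - harm (k + 1)" "real k"] show ?thesis
      by (simp add: right_diff_distrib)
  qed
  finally show ?thesis .
qed

context atomless_iid_sequence
begin

text \<open>
  The coordinate at \<open>i\<close> is smaller than each of the next \<open>k\<close> coordinates.
\<close>
definition window_min :: "nat \<Rightarrow> nat \<Rightarrow> (nat \<Rightarrow> real) \<Rightarrow> bool" where
  "window_min k i \<omega> \<longleftrightarrow> (\<forall>j\<in>{1..k}. \<omega> i < \<omega> (i + j))"

lemma window_min_measurable [measurable]: "Measurable.pred seq_space (window_min k i)"
  unfolding window_min_def[abs_def] by measurable

lemma prob_window_min: "prob {\<omega>. window_min k i \<omega>} = 1 / real (k + 1)"
proof -
  have "prob (space seq_space \<inter> {\<omega>. \<forall>j\<in>{i..i + k} - {i}. \<omega> i < \<omega> j}) = prob (space seq_space) / card {i..i + k}"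
    by (rule prob_minimum[OF _ _ sets.top]) auto
  moreover have "(\<forall>j\<in>{i..i + k} - {i}. \<omega> i < \<omega> j) \<longleftrightarrow> window_min k i \<omega>" for \<omega> :: "nat \<Rightarrow> real"
  proof -
    have "{i..i + k} - {i} = (+) i ` {1..k}" by auto
    then show ?thesis by (simp only: window_min_def Ball_image_comp comp_def)
  qed
  ultimately show ?thesis using prob_space by simp
qed

text \<open>
  If both events occur, then coordinate \<open>0\<close> is the smallest of the coordinates from \<open>0\<close> to \<open>d + k\<close>, which
  is symmetric in the coordinates from \<open>d\<close> to \<open>d + k\<close>, and coordinate \<open>d\<close> is the smallest of the latter.
\<close>
lemma prob_window_min_joint:
  assumes d: "1 \<le> d" "d \<le> k"
  shows "prob {\<omega>. window_min k 0 \<omega> \<and> window_min k d \<omega>} = 1 / (real (k + 1) * real (k + 1 + d))"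
proof -
  let ?F = "{\<omega>. window_min (d + k) 0 \<omega>}" and ?T = "{d..d + k}"
  have F: "?F \<in> sets seq_space"
    using window_min_measurable[of "d + k" 0] by (simp add: pred_def)
  have "prob (?F \<inter> {\<omega>. \<forall>j\<in>?T - {d}. \<omega> d < \<omega> j}) = prob ?F / card ?T"
  proof (rule prob_minimum[OF _ _ F])
    fix i j and \<omega> :: "nat \<Rightarrow> real" assume ij: "i \<in> ?T" "j \<in> ?T"
    let ?\<tau> = "Transposition.transpose i j"
    have \<tau>0: "?\<tau> 0 = 0" using ij d by (simp add: Transposition.transpose_def)
    have "?\<tau> ` {1..d + k} = {1..d + k}"
      using ij d by (intro permutes_image permutes_swap_id) auto
    have "window_min (d + k) 0 (\<omega> \<circ> ?\<tau>) \<longleftrightarrow> (\<forall>l\<in>?\<tau> ` {1..d + k}. \<omega> 0 < \<omega> l)"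
      by (simp only: window_min_def \<tau>0 add_0 Ball_image_comp comp_def)
    also have "\<dots> \<longleftrightarrow> window_min (d + k) 0 \<omega>"
      unfolding \<open>?\<tau> ` {1..d + k} = {1..d + k}\<close> by (simp add: window_min_def)
    finally show "\<omega> \<in> ?F \<longleftrightarrow> \<omega> \<circ> ?\<tau> \<in> ?F" by simp
  qed auto
  also have "?F \<inter> {\<omega>. \<forall>j\<in>?T - {d}. \<omega> d < \<omega> j} = {\<omega>. window_min k 0 \<omega> \<and> window_min k d \<omega>}"
  proof -
    have "window_min (d + k) 0 \<omega> \<and> (\<forall>j\<in>?T - {d}. \<omega> d < \<omega> j) \<longleftrightarrow> window_min k 0 \<omega> \<and> window_min k d \<omega>"
      for \<omega> :: "nat \<Rightarrow> real"
    proof (intro iffI conjI)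
      assume *: "window_min (d + k) 0 \<omega> \<and> (\<forall>j\<in>?T - {d}. \<omega> d < \<omega> j)"
      then show "window_min k 0 \<omega>" by (auto simp: window_min_def)
      show "window_min k d \<omega>" unfolding window_min_def
      proof
        fix j assume "j \<in> {1..k}"
        then have "d + j \<in> ?T - {d}" by auto
        with * show "\<omega> d < \<omega> (d + j)" by blast
      qed
    next
      assume *: "window_min k 0 \<omega> \<and> window_min k d \<omega>"
      then have 0: "\<omega> 0 < \<omega> j" if "j \<in> {1..k}" for j using that by (simp add: window_min_def)
      from * have 1: "\<omega> d < \<omega> (d + j)" if "j \<in> {1..k}" for j using that by (simp add: window_min_def)
      show 2: "\<forall>j\<in>?T - {d}. \<omega> d < \<omega> j"
      proof
        fix j assume "j \<in> ?T - {d}"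
        then have "j - d \<in> {1..k}" "j = d + (j - d)" by auto
        then show "\<omega> d < \<omega> j" using 1 by metis
      qed
      show "window_min (d + k) 0 \<omega>" unfolding window_min_def
      proof
        fix j assume j: "j \<in> {1..d + k}"
        show "\<omega> 0 < \<omega> (0 + j)"
        proof (cases "j \<le> k")
          case True
          then show ?thesis using 0[of j] j by auto
        next
          case False
          then have "\<omega> d < \<omega> j" using 2 j d by auto
          moreover have "\<omega> 0 < \<omega> d" using 0[of d] d by auto
          ultimately show ?thesis by simp
        qed
      qed
    qed
    then show ?thesis by blast
  qed
  finally show ?thesis by (simp add: prob_window_min algebra_simps)
qed

lemma count_runs_map_upt:
  "count_runs k (map \<omega> [0..<m]) = card {i. i + k < m \<and> window_min k i \<omega>}"
  unfolding count_runs_eq_card window_min_def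
  by (rule arg_cong[where f=card]) auto

text \<open>
  The relative order of the first \<open>m\<close> coordinates is that of a uniform permutation. To see this for
  the statistic \<open>count_runs k\<close>, the expectation is averaged over all rearrangements of the \<open>m\<close>
  coordinates, which does not change it. As the coordinates are almost surely distinct, the average
  under the integral is almost surely a constant.
\<close>
lemma expectation_count_runs:
  fixes h :: "nat \<Rightarrow> complex"
  shows "(\<integral>\<omega>. h (card {i. i + k < m \<and> window_min k i \<omega>}) \<partial>seq_space) =
    (\<Sum>xs\<in>permutations_of_set {2..m + 1}. h (count_runs k xs)) / fact m"
proof -
  define G where "G x = h (count_runs k (map x [0..<m]))" for x :: "nat \<Rightarrow> real"
  have [measurable]: "(\<lambda>x. count_runs k (map x [0..<m])) \<in> measurable (PiM {..<m} (\<lambda>_. D)) (count_space UNIV)"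
  proof -
    have "{x \<in> space (PiM {..<m} (\<lambda>_. D)). i + k < m \<and> window_min k i x} \<in> sets (PiM {..<m} (\<lambda>_. D))" for i
    proof (cases "i + k < m")
      case True
      have "(\<lambda>x. x j) \<in> borel_measurable (PiM {..<m} (\<lambda>_. D))" if "j < m" for j
        using measurable_component_singleton[of j "{..<m}" "\<lambda>_. D"] that by (simp add: measurable_cong_sets[OF refl sets_D])
      then have "{x \<in> space (PiM {..<m} (\<lambda>_. D)). window_min k i x} \<in> sets (PiM {..<m} (\<lambda>_. D))"
        using True unfolding window_min_def
        by (intro sets.sets_Collect_finite_All borel_measurable_less) auto
      then show ?thesis using True by simp
    qed simp
    then show ?thesis unfolding count_runs_map_upt by (intro measurable_card) (simp only: mem_Collect_eq)
  qed
  have G [measurable]: "G \<in> borel_measurable (PiM {..<m} (\<lambda>_. D))"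
    unfolding G_def by (rule measurable_compose[where N="count_space UNIV"]) simp_all
  have perm: "(\<lambda>i\<in>{..<m}. \<omega> (xs ! i)) = restrict ((!) (map \<omega> xs)) {..<m}" "map (restrict ((!) (map \<omega> xs)) {..<m}) [0..<m] = map \<omega> xs"
    if "xs \<in> permutations_of_set {..<m}" for xs and \<omega> :: "nat \<Rightarrow> real"
  proof -
    have "length xs = m" using length_finite_permutations_of_set[OF that] by simp
    then show "(\<lambda>i\<in>{..<m}. \<omega> (xs ! i)) = restrict ((!) (map \<omega> xs)) {..<m}" by (auto simp: fun_eq_iff)
    show "map (restrict ((!) (map \<omega> xs)) {..<m}) [0..<m] = map \<omega> xs"
      using \<open>length xs = m\<close> by (intro nth_equalityI) auto
  qed
  have bounded: "norm (h (count_runs k (map \<omega> xs))) \<le> Max ((\<lambda>n. norm (h n)) ` {..m})"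
    if "xs \<in> permutations_of_set {..<m}" for xs and \<omega> :: "nat \<Rightarrow> real"
  proof (rule Max_ge)
    have "count_runs k (map \<omega> xs) \<le> card {..<length (map \<omega> xs)}"
      unfolding count_runs_eq_card by (rule card_mono) auto
    then show "norm (h (count_runs k (map \<omega> xs))) \<in> (\<lambda>n. norm (h n)) ` {..m}"
      using length_finite_permutations_of_set[OF that] by auto
  qed simp
  have meas: "(\<lambda>\<omega>. h (count_runs k (map \<omega> xs))) \<in> borel_measurable seq_space" if "xs \<in> permutations_of_set {..<m}" for xs
  proof -
    have "(\<lambda>\<omega>. G (\<lambda>i\<in>{..<m}. \<omega> (xs ! i))) \<in> borel_measurable seq_space" by measurable
    then show ?thesis unfolding G_def by (simp only: perm[OF that])
  qed
  have int: "integrable seq_space (\<lambda>\<omega>. h (count_runs k (map \<omega> xs)))" if "xs \<in> permutations_of_set {..<m}" for xs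
    using bounded[OF that] meas[OF that] by (intro integrable_const_bound) auto
  have ex: "(\<integral>\<omega>. h (count_runs k (map \<omega> xs)) \<partial>seq_space) = (\<integral>\<omega>. h (count_runs k (map \<omega> [0..<m])) \<partial>seq_space)"
    if xs: "xs \<in> permutations_of_set {..<m}" for xs
  proof -
    have id: "[0..<m] \<in> permutations_of_set {..<m}" by (auto simp: permutations_of_set_def)
    have "inj_on ((!) ys) {..<m}" if "ys \<in> permutations_of_set {..<m}" for ys
      using that length_finite_permutations_of_set[OF that]
      by (auto simp: permutations_of_set_def inj_on_def nth_eq_iff_index_eq)
    from expectation_reindex[OF this[OF xs] this[OF id] G]
    show ?thesis unfolding G_def by (simp only: perm[OF xs] perm[OF id])
  qed
  have "(\<Sum>xs\<in>permutations_of_set {..<m}. (\<integral>\<omega>. h (count_runs k (map \<omega> xs)) \<partial>seq_space)) =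
     (\<integral>\<omega>. (\<Sum>xs\<in>permutations_of_set {..<m}. h (count_runs k (map \<omega> xs))) \<partial>seq_space)"
    using int by (subst Bochner_Integration.integral_sum) auto
  also have "\<dots> = (\<integral>\<omega>. (\<Sum>xs\<in>permutations_of_set {2..m + 1}. h (count_runs k xs)) \<partial>seq_space)"
  proof (rule integral_cong_AE)
    show "AE \<omega> in seq_space. (\<Sum>xs\<in>permutations_of_set {..<m}. h (count_runs k (map \<omega> xs))) =
        (\<Sum>xs\<in>permutations_of_set {2..m + 1}. h (count_runs k xs))"
      using AE_inj
    proof eventually_elim
      case (elim \<omega>)
      then have inj: "inj_on \<omega> {..<m}" by (rule inj_on_subset) simp
      have "(\<Sum>xs\<in>permutations_of_set {..<m}. h (count_runs k (map \<omega> xs))) =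
          (\<Sum>xs\<in>permutations_of_set (\<omega> ` {..<m}). h (count_runs k xs))"
        by (rule sum_permutations_inj_map[OF inj, symmetric])
      also have "\<dots> = (\<Sum>xs\<in>permutations_of_set {2..m + 1}. h (count_runs k xs))"
        using inj by (intro sum_count_runs_permutations) (auto simp: card_image)
      finally show ?case .
    qed
  qed (use meas in \<open>auto intro: borel_measurable_sum\<close>)
  also have "\<dots> = (\<Sum>xs\<in>permutations_of_set {2..m + 1}. h (count_runs k xs))"
    by (simp add: prob_space del: space_seq_space)
  finally have "fact m * (\<integral>\<omega>. h (count_runs k (map \<omega> [0..<m])) \<partial>seq_space) =
      (\<Sum>xs\<in>permutations_of_set {2..m + 1}. h (count_runs k xs))"
    by (simp add: ex)
  then show ?thesis unfolding count_runs_map_upt by (simp add: field_simps)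
qed

text \<open>
  The indicator of the event \<open>window_min k i\<close> minus its probability.
\<close>
definition centred_window_min :: "nat \<Rightarrow> nat \<Rightarrow> (nat \<Rightarrow> real) \<Rightarrow> real" where
  "centred_window_min k i \<omega> = of_bool (window_min k i \<omega>) - 1 / real (k + 1)"

lemma expectation_of_bool:
  assumes [measurable]: "Measurable.pred seq_space P"
  shows "expectation (\<lambda>\<omega>. of_bool (P \<omega>)) = prob {\<omega>. P \<omega>}"
    and "integrable seq_space (\<lambda>\<omega>. of_bool (P \<omega>) :: real)"
proof -
  have "{\<omega>. P \<omega>} \<in> sets seq_space" using assms by (simp add: pred_def)
  moreover have "(\<lambda>\<omega>. of_bool (P \<omega>)) = (indicator {\<omega>. P \<omega>} :: _ \<Rightarrow> real)"
    by (simp add: indicator_def fun_eq_iff)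
  ultimately show "expectation (\<lambda>\<omega>. of_bool (P \<omega>)) = prob {\<omega>. P \<omega>}"
    "integrable seq_space (\<lambda>\<omega>. of_bool (P \<omega>) :: real)"
    by (simp_all add: integrable_indicator_iff emeasure_eq_measure)
qed

lemma expectation_centred_window_min: "expectation (centred_window_min k i) = 0"
  unfolding centred_window_min_def[abs_def]
  using expectation_of_bool[of "window_min k i"] prob_space by (simp add: prob_window_min)

lemma covariance_window_min:
  "expectation (\<lambda>\<omega>. centred_window_min k i \<omega> * centred_window_min k j \<omega>) =
    prob {\<omega>. window_min k i \<omega> \<and> window_min k j \<omega>} - 1 / real (k + 1) ^ 2"
proof -
  let ?p = "1 / real (k + 1)" and ?a = "\<lambda>i \<omega>. of_bool (window_min k i \<omega>) :: real"
  have a: "expectation (?a i) = ?p" "integrable seq_space (?a i)" for i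
    using expectation_of_bool[of "window_min k i"] by (simp_all add: prob_window_min)
  have b: "expectation (\<lambda>\<omega>. of_bool (window_min k i \<omega> \<and> window_min k j \<omega>)) = prob {\<omega>. window_min k i \<omega> \<and> window_min k j \<omega>}"
    "integrable seq_space (\<lambda>\<omega>. of_bool (window_min k i \<omega> \<and> window_min k j \<omega>) :: real)"
    by (rule expectation_of_bool; measurable)+
  have prod: "(\<lambda>\<omega>. centred_window_min k i \<omega> * centred_window_min k j \<omega>) =
      (\<lambda>\<omega>. of_bool (window_min k i \<omega> \<and> window_min k j \<omega>) - ?p * ?a i \<omega> - ?p * ?a j \<omega> + ?p * ?p)"
    by (auto simp: centred_window_min_def fun_eq_iff algebra_simps)
  have "expectation (\<lambda>\<omega>. of_bool (window_min k i \<omega> \<and> window_min k j \<omega>) - ?p * ?a i \<omega> - ?p * ?a j \<omega> + ?p * ?p)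
      = prob {\<omega>. window_min k i \<omega> \<and> window_min k j \<omega>} - ?p * ?p - ?p * ?p + ?p * ?p"
    using a b prob_space by simp
  also have "\<dots> = prob {\<omega>. window_min k i \<omega> \<and> window_min k j \<omega>} - 1 / real (k + 1) ^ 2"
    by (simp add: power2_eq_square)
  finally show ?thesis by (simp only: prod)
qed

lemma central_limit_window_min:
  assumes k: "k \<ge> 1"
  defines "v \<equiv> 1 / real (k + 1) + (2 * harm (2 * k + 1) - 2 * harm (k + 1)) / real (k + 1)
           - real (2 * k + 1) / real (k + 1) ^ 2"
  shows "(\<lambda>N. char (distr seq_space borel
      (\<lambda>\<omega>. (\<Sum>i<N. centred_window_min k i \<omega>) / sqrt (real (N + (k + 1)) * v))) t)
    \<longlonglongrightarrow> char std_normal_distribution t"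
proof -
  define g where "g x = of_bool (\<forall>j\<in>{1..k}. x 0 < x j) - 1 / real (k + 1)" for x :: "nat \<Rightarrow> real"
  define c where "c d = expectation (\<lambda>\<omega>. centred_window_min k 0 \<omega> * centred_window_min k d \<omega>)" for d
  have g: "g \<in> borel_measurable (PiM {..k} (\<lambda>_. D))"
  proof -
    have "(\<lambda>x. x j) \<in> borel_measurable (PiM {..k} (\<lambda>_. D))" if "j \<le> k" for j
      using measurable_component_singleton[of j "{..k}" "\<lambda>_. D"] that by (simp add: measurable_cong_sets[OF refl sets_D])
    then have [measurable]: "Measurable.pred (PiM {..k} (\<lambda>_. D)) (\<lambda>x. \<forall>j\<in>{1..k}. x 0 < x j)"
      unfolding pred_def by (intro sets.sets_Collect_finite_All borel_measurable_less) auto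
    show ?thesis unfolding g_def by measurable
  qed
  have X: "centred_window_min k = (\<lambda>i \<omega>. g (\<lambda>j\<in>{..k}. \<omega> (i + j)))"
    by (auto simp: fun_eq_iff centred_window_min_def g_def window_min_def)
  have "integrable seq_space (\<lambda>\<omega>. (centred_window_min k 0 \<omega>)\<^sup>2)"
  proof (rule integrable_const_bound[where B = 1])
    have "\<bar>centred_window_min k 0 \<omega>\<bar> \<le> 1" for \<omega>
      by (auto simp: centred_window_min_def abs_if)
    then show "AE \<omega> in seq_space. norm ((centred_window_min k 0 \<omega>)\<^sup>2) \<le> 1"
      by (simp add: abs_square_le_1)
    show "(\<lambda>\<omega>. (centred_window_min k 0 \<omega>)\<^sup>2) \<in> borel_measurable seq_space"
      unfolding centred_window_min_def[abs_def] by measurable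
  qed
  then have "stationary_m_dependent seq_space (centred_window_min k) c k"
    unfolding c_def[abs_def]
    using stationary_m_dependent_window[OF g] expectation_centred_window_min[of k 0] by (simp only: X)
  then interpret W: stationary_m_dependent seq_space "centred_window_min k" c k .
  have c0: "c 0 = 1 / real (k + 1) - 1 / real (k + 1) ^ 2"
    unfolding c_def covariance_window_min by (simp add: prob_window_min)
  have cd: "c d = 1 / real (k + 1) * (1 / real (k + 1 + d)) - 1 / real (k + 1) ^ 2" if "d \<in> {1..k}" for d
    unfolding c_def covariance_window_min using that by (subst prob_window_min_joint) auto
  have "(\<Sum>d\<in>{1..k}. c d) = (\<Sum>d\<in>{1..k}. 1 / real (k + 1) * (1 / real (k + 1 + d)) - 1 / real (k + 1) ^ 2)"
    by (intro sum.cong cd refl)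
  also have "\<dots> = 1 / real (k + 1) * (harm (2 * k + 1) - harm (k + 1)) - real k / real (k + 1) ^ 2"
  proof -
    have H: "harm (2 * k + 1) - harm (k + 1) = (\<Sum>d\<in>{1..k}. 1 / real (k + 1 + d))"
      using harm_add_diff[of "k + 1" k] by (simp add: mult_2)
    show ?thesis unfolding H sum_subtractf sum_distrib_left[symmetric] by simp
  qed
  finally have "W.asymptotic_variance = 1 / real (k + 1) - 1 / real (k + 1) ^ 2
      + 2 * (1 / real (k + 1) * (harm (2 * k + 1) - harm (k + 1)) - real k / real (k + 1) ^ 2)"
    unfolding W.asymptotic_variance_def c0 by simp
  also have "\<dots> = v"
  proof -
    have "1 / q - 1 / q ^ 2 + 2 * (1 / q * (x - y) - z / q ^ 2) = 1 / q + (2 * x - 2 * y) / q - (2 * z + 1) / q ^ 2"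
      if "q > 0" for q x y z :: real
      using that by (simp add: field_simps power2_eq_square)
    from this[of "real (k + 1)" "harm (2 * k + 1)" "harm (k + 1)" "real k"] show ?thesis
      by (simp add: v_def)
  qed
  finally have v: "W.asymptotic_variance = v" .
  moreover have "v > 0" unfolding v_def by (rule limiting_variance_pos[OF k])
  ultimately show ?thesis using W.central_limit_offset[of "k + 1" t] by simp
qed

text \<open>
  For the order \<open>n = N + (k + 1)\<close>, the centred number of nodes with at least \<open>k\<close> descendants has the law of
  a partial sum of length \<open>N\<close>: the root contributes \<open>1\<close>, and of the \<open>n - 1\<close> letters behind it exactly the
  first \<open>N\<close> are followed by at least \<open>k\<close> letters. The centring \<open>n / (k + 1)\<close> is exactly the mean.
\<close>
lemma char_num_nodes_ge:
  fixes b t :: real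
  shows "char (distr (measure_pmf (urt (N + (k + 1)))) borel (\<lambda>T. (real (num_nodes_ge k (N + (k + 1)) T) - real (N + (k + 1)) / real (k + 1)) / b)) t =
    char (distr seq_space borel (\<lambda>\<omega>. (\<Sum>i<N. centred_window_min k i \<omega>) / b)) t"
proof -
  let ?n = "N + (k + 1)" and ?m = "N + k"
  let ?trees = "increasing_trees (?m + 1)"
  define h where "h j = iexp (t * ((real j - real ?n / real (k + 1)) / b))" for j
  have card: "card ?trees = fact ?m" using card_increasing_trees[of "?m + 1"] by simp
  then have ne: "?trees \<noteq> {}" by (metis card.empty fact_nonzero)
  have "char (distr (measure_pmf (urt ?n)) borel (\<lambda>T. (real (num_nodes_ge k ?n T) - real ?n / real (k + 1)) / b)) t =
      (\<integral>T. h (num_nodes_ge k ?n T) \<partial>measure_pmf (urt ?n))"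
    unfolding char_def h_def by (subst integral_distr) simp_all
  also have "\<dots> = (\<Sum>T\<in>?trees. h (num_nodes_ge k (?m + 1) T)) / fact ?m"
  proof -
    have "urt ?n = pmf_of_set ?trees" by (simp add: urt_def)
    then show ?thesis
      using ne finite_increasing_trees[of "?m + 1"] card
      by (subst integral_measure_pmf[of ?trees])
        (auto simp: scaleR_conv_of_real sum_divide_distrib indicator_def)
  qed
  also have "\<dots> = (\<Sum>xs\<in>permutations_of_set {2..?m + 1}. h (Suc (count_runs k xs))) / fact ?m"
    by (subst sum_increasing_trees) simp_all
  also have "\<dots> = (\<integral>\<omega>. h (Suc (card {i. i + k < ?m \<and> window_min k i \<omega>})) \<partial>seq_space)"
    by (rule expectation_count_runs[symmetric, where h = "\<lambda>j. h (Suc j)"])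
  also have "\<dots> = (\<integral>\<omega>. iexp (t * ((\<Sum>i<N. centred_window_min k i \<omega>) / b)) \<partial>seq_space)"
  proof (rule Bochner_Integration.integral_cong[OF refl])
    fix \<omega>
    have "(\<Sum>i<N. of_bool (window_min k i \<omega>)) = real (card {i. i + k < ?m \<and> window_min k i \<omega>})"
      by (simp add: of_bool_def sum.If_cases Int_def)
    then have "(\<Sum>i<N. centred_window_min k i \<omega>) =
        real (card {i. i + k < ?m \<and> window_min k i \<omega>}) - real N / real (k + 1)"
      by (simp add: centred_window_min_def sum_subtractf)
    also have "\<dots> = real (Suc (card {i. i + k < ?m \<and> window_min k i \<omega>})) - real ?n / real (k + 1)"
    proof -
      have "real ?n / real (k + 1) = real N / real (k + 1) + 1"
        unfolding of_nat_add[of N "k + 1"] by (simp add: add_divide_distrib del: of_nat_add)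
      then show ?thesis by simp
    qed
    finally show "h (Suc (card {i. i + k < ?m \<and> window_min k i \<omega>})) = iexp (t * ((\<Sum>i<N. centred_window_min k i \<omega>) / b))"
      by (simp only: h_def)
  qed
  also have "\<dots> = char (distr seq_space borel (\<lambda>\<omega>. (\<Sum>i<N. centred_window_min k i \<omega>) / b)) t"
  proof -
    have [measurable]: "centred_window_min k i \<in> borel_measurable seq_space" for i
      unfolding centred_window_min_def[abs_def] by measurable
    show ?thesis unfolding char_def by (subst integral_distr) simp_all
  qed
  finally show ?thesis .
qed

end

lemma atomless_iid_sequence_uniform: "atomless_iid_sequence (uniform_measure lborel {0..1})"
proof (intro atomless_iid_sequence.intro iid_sequence.intro atomless_iid_sequence_axioms.intro)
  show "emeasure (uniform_measure lborel {0..1}) {x} = 0" for x :: real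
    by (subst emeasure_uniform_measure) (auto simp: emeasure_lborel_countable Int_insert_left)
  show "prob_space (uniform_measure lborel {0..1 :: real})"
    by (rule prob_space_uniform_measure) auto
qed simp

section \<open>Asymptotic normality\<close>

theorem theorem5p2:
  fixes k :: nat
  assumes "k \<ge> 1"
  shows "weak_conv_m
    (\<lambda>n. distr (measure_pmf (urt n)) borel
      (\<lambda>T. (real (num_nodes_ge k n T) - real n / real (k + 1)) /
            sqrt (real n *
              (1 / real (k + 1)
               + (2 * harm (2 * k + 1) - 2 * harm (k + 1)) / real (k + 1)
               - real (2 * k + 1) / real (k + 1) ^ 2))))
    std_normal_distribution"
proof (rule levy_continuity)
  interpret U: atomless_iid_sequence "uniform_measure lborel {0..1}"
    by (rule atomless_iid_sequence_uniform)
  let ?v = "1 / real (k + 1) + (2 * harm (2 * k + 1) - 2 * harm (k + 1)) / real (k + 1)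
    - real (2 * k + 1) / real (k + 1) ^ 2"
  fix t :: real
  have "(\<lambda>N. char (distr (measure_pmf (urt (N + (k + 1)))) borel
      (\<lambda>T. (real (num_nodes_ge k (N + (k + 1)) T) - real (N + (k + 1)) / real (k + 1))
        / sqrt (real (N + (k + 1)) * ?v))) t) \<longlonglongrightarrow> char std_normal_distribution t"
    unfolding U.char_num_nodes_ge by (rule U.central_limit_window_min[OF assms])
  then show "(\<lambda>n. char (distr (measure_pmf (urt n)) borel
      (\<lambda>T. (real (num_nodes_ge k n T) - real n / real (k + 1)) / sqrt (real n * ?v))) t)
      \<longlonglongrightarrow> char std_normal_distribution t"
    by (rule LIMSEQ_offset)
next
  show "real_distribution (distr (measure_pmf (urt n)) borel
      (\<lambda>T. (real (num_nodes_ge k n T) - real n / real (k + 1)) /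
            sqrt (real n *
              (1 / real (k + 1)
               + (2 * harm (2 * k + 1) - 2 * harm (k + 1)) / real (k + 1)
               - real (2 * k + 1) / real (k + 1) ^ 2))))" for n
    by (rule prob_space.real_distribution_distr[OF prob_space_measure_pmf]) simp
qed (rule real_dist_normal_dist)

end
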